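(* There exist sequences $(a_m)_{m \geq 0}$ and $(b_m)_{m \geq 0}$ of non-negative integers with $$\exp\left[m \log m + O(m)\right] \geq a_m \geq b_m \geq \exp\left[m \log m + O(m \log \log m)\right]$$ (as $m\to\infty$) such that the following hold. 1. For every family $\mathcal{F}$ of graphs (non-empty, with $e(F)\ge 1$ for all $F\in\mathcal{F}$): (a) $sat(n,\mathcal{F})=O(n)$; (b) for every integer $m \geq 0$, the set $\{n \in \mathbb{Z}_{\geq 0} : sat(n,\mathcal{F})=m\}$ is the union of at most $a_m$ intervals; (c) $sat(n,\mathcal{F})$ either tends to infinity as $n\to\infty$ or is eventually constant. 2. Let $(s_n)_{n \geq 0}$ be a sequence of integers such that (a) $s_n=O(n)$; (b) for every large enough integer $m$, the set $\{n \in \mathbb{Z}_{\geq 0} : s_n=m\}$ is the union of at most $b_m$ intervals; (c) $s_n \to \infty$ as $n \to \infty$. Then there exists a family $\mathcal{F}$ of graphs such that $sat(n,\mathcal{F})=s_n$ for all large enough $n$. 3. For every integer $m \geq 0$, there exists a finite family $\mathcal{F}$ of graphs such that $sat(n,\mathcal{F})=m$ for all large enough $n$.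
   Context: All graphs are finite and simple; a graph $G$ contains $F$ if $G$ has a (not necessarily induced) subgraph isomorphic to $F$. For a non-empty family $\mathcal{F}$ of graphs each having at least one edge, a graph $G$ is $\mathcal{F}$-saturated if $G$ contains no graph of $\mathcal{F}$ but for every pair of non-adjacent vertices $u,v$ of $G$, the graph $G+uv$ contains some graph of $\mathcal{F}$. $sat(n,\mathcal{F})$ is the minimum number of edges of an $\mathcal{F}$-saturated graph on $n$ vertices. An interval is a set $I$ of integers such that whenever $a\le b\le c$ are integers with $a,c\in I$ we have $b\in I$ (so intervals may be empty or infinite). *)

theory Defs
  imports Complex_Main "HOL-Library.Landau_Symbols"
begin

section \<open>Finite simple graphs\<close>

text \<open>A graph is a pair of a vertex set and a set of two-element subsets of it.\<close>

type_synonym 'a graph = "'a set \<times> 'a set set"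

abbreviation verts :: "'a graph \<Rightarrow> 'a set" where
  "verts G \<equiv> fst G"

abbreviation edges :: "'a graph \<Rightarrow> 'a set set" where
  "edges G \<equiv> snd G"

definition simple_graph :: "'a graph \<Rightarrow> bool" where
  "simple_graph G \<longleftrightarrow> finite (verts G) \<and> (\<forall>e\<in>edges G. e \<subseteq> verts G \<and> card e = 2)"

definition subgraph :: "'a graph \<Rightarrow> 'a graph \<Rightarrow> bool" where
  "subgraph H G \<longleftrightarrow> simple_graph H \<and> verts H \<subseteq> verts G \<and> edges H \<subseteq> edges G"

definition graph_iso :: "'a graph \<Rightarrow> 'b graph \<Rightarrow> bool" where
  "graph_iso G H \<longleftrightarrow> (\<exists>f. bij_betw f (verts G) (verts H) \<and>
     (\<forall>u\<in>verts G. \<forall>v\<in>verts G. {u, v} \<in> edges G \<longleftrightarrow> {f u, f v} \<in> edges H))"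

definition contains_graph :: "'a graph \<Rightarrow> 'b graph \<Rightarrow> bool" where
  "contains_graph G F \<longleftrightarrow> (\<exists>H. subgraph H G \<and> graph_iso H F)"

definition add_edge :: "'a graph \<Rightarrow> 'a \<Rightarrow> 'a \<Rightarrow> 'a graph" where
  "add_edge G u v = (verts G, insert {u, v} (edges G))"


section \<open>Saturation\<close>

text \<open>Every finite graph is isomorphic to one with vertices in \<^typ>\<open>nat\<close>, and all notions
  below are invariant under isomorphism, so families of graphs are sets of graphs on \<^typ>\<open>nat\<close>.\<close>

definition graph_family :: "nat graph set \<Rightarrow> bool" where
  "graph_family \<F> \<longleftrightarrow> \<F> \<noteq> {} \<and> (\<forall>F\<in>\<F>. simple_graph F \<and> card (edges F) \<ge> 1)"

definition saturated :: "nat graph set \<Rightarrow> 'a graph \<Rightarrow> bool" where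
  "saturated \<F> G \<longleftrightarrow> simple_graph G \<and>
     (\<forall>F\<in>\<F>. \<not> contains_graph G F) \<and>
     (\<forall>u\<in>verts G. \<forall>v\<in>verts G. u \<noteq> v \<and> {u, v} \<notin> edges G \<longrightarrow>
        (\<exists>F\<in>\<F>. contains_graph (add_edge G u v) F))"

definition sat :: "nat \<Rightarrow> nat graph set \<Rightarrow> nat" where
  "sat n \<F> = (LEAST m. \<exists>G :: nat graph. saturated \<F> G \<and> card (verts G) = n \<and> card (edges G) = m)"

text \<open>The minimum defining \<^const>\<open>sat\<close> is over a non-empty set.\<close>

lemma ex_saturated:
  assumes "graph_family \<F>"
  shows "\<exists>G :: nat graph. saturated \<F> G \<and> card (verts G) = n"
proof -
  define P where "P k \<longleftrightarrow> (\<exists>G :: nat graph. simple_graph G \<and> verts G = {..<n} \<and>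
    (\<forall>F\<in>\<F>. \<not> contains_graph G F) \<and> card (edges G) = k)" for k
  have fin: "finite (edges G) \<and> card (edges G) \<le> 2 ^ n"
    if "simple_graph G" "verts G = {..<n}" for G :: "nat graph"
  proof -
    have sub: "edges G \<subseteq> Pow {..<n}"
      using that by (auto simp: simple_graph_def)
    then have "card (edges G) \<le> card (Pow {..<n})"
      by (intro card_mono) auto
    then show ?thesis
      using sub by (simp add: card_Pow finite_subset[OF sub])
  qed
  have "P 0"
  proof -
    have "\<not> contains_graph ({..<n}, {}) F" if "F \<in> \<F>" for F
    proof
      assume "contains_graph ({..<n}, {}) F"
      then obtain H :: "nat graph" and f where H: "edges H = {}"
        and f: "bij_betw f (verts H) (verts F)"
        and iso: "\<forall>u\<in>verts H. \<forall>v\<in>verts H. {u, v} \<in> edges H \<longleftrightarrow> {f u, f v} \<in> edges F"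
        by (auto simp: contains_graph_def subgraph_def graph_iso_def)
      have sF: "simple_graph F" and "card (edges F) \<ge> 1"
        using assms that by (auto simp: graph_family_def)
      then obtain e where e: "e \<in> edges F"
        by fastforce
      then obtain x y where xy: "e = {x, y}" "x \<in> verts F" "y \<in> verts F"
        using sF by (auto simp: simple_graph_def card_2_iff)
      moreover have "f ` verts H = verts F"
        using f by (rule bij_betw_imp_surj_on)
      ultimately obtain u v where "u \<in> verts H" "v \<in> verts H" "f u = x" "f v = y"
        by (metis imageE)
      then show False
        using iso H e xy by auto
    qed
    then show ?thesis
      unfolding P_def by (intro exI[of _ "({..<n}, {})"]) (auto simp: simple_graph_def)
  qed
  moreover have "\<forall>k. P k \<longrightarrow> k \<le> 2 ^ n"
    using fin by (auto simp: P_def)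
  ultimately obtain k where k: "P k" "\<And>j. P j \<Longrightarrow> j \<le> k"
    using Nat.ex_has_greatest_nat[of P 0 "2 ^ n"] by blast
  then obtain G :: "nat graph" where G: "simple_graph G" "verts G = {..<n}"
    "\<forall>F\<in>\<F>. \<not> contains_graph G F" "card (edges G) = k"
    by (auto simp: P_def)
  have "\<exists>F\<in>\<F>. contains_graph (add_edge G u v) F"
    if uv: "u \<in> verts G" "v \<in> verts G" "u \<noteq> v" "{u, v} \<notin> edges G" for u v
  proof (rule ccontr)
    assume "\<not> ?thesis"
    moreover have "simple_graph (add_edge G u v)" "verts (add_edge G u v) = {..<n}"
      using G uv by (auto simp: simple_graph_def add_edge_def card_2_iff)
    moreover have "card (edges (add_edge G u v)) = Suc k"
      using G uv fin[of G] by (auto simp: add_edge_def)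
    ultimately have "P (Suc k)"
      unfolding P_def by blast
    then show False
      using k(2) by fastforce
  qed
  then show ?thesis
    using G by (intro exI[of _ G]) (auto simp: saturated_def)
qed


section \<open>Intervals of integers\<close>

definition int_interval :: "int set \<Rightarrow> bool" where
  "int_interval I \<longleftrightarrow> (\<forall>a b c. a \<le> b \<and> b \<le> c \<and> a \<in> I \<and> c \<in> I \<longrightarrow> b \<in> I)"

definition union_of_at_most_intervals :: "nat \<Rightarrow> int set \<Rightarrow> bool" where
  "union_of_at_most_intervals k S \<longleftrightarrow>
     (\<exists>\<I>. finite \<I> \<and> card \<I> \<le> k \<and> (\<forall>I\<in>\<I>. int_interval I) \<and> S = \<Union>\<I>)"

end

theory Submission
  imports Defs "HOL-Library.FuncSet" "HOL-Library.Nat_Bijection" "HOL-Real_Asymp.Real_Asymp"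
begin

text \<open>
  Up to isolated vertices there are only \<open>exp (m log m + O(m))\<close> graphs with \<open>m\<close> edges, and the orders at
  which one of them is saturated form an interval apart from the two smallest orders.
  This bounds the number of intervals on which \<open>sat\<close> equals \<open>m\<close>, and hence gives the dichotomy.

  Conversely, forbidding a family amounts to prescribing a class of graphs closed under subgraphs. Given \<open>s\<close>,
  let the extremal graph on \<open>n\<close> vertices be a graph \<open>Q n\<close> joined to \<open>t\<close> apexes, plus isolated
  vertices, with \<open>s n\<close> edges in total. Besides the subgraphs of these, admit every graph that avoids all
  \<open>Q k\<close> with \<open>k \<le> n\<close> after the deletion of \<open>t\<close> vertices; maximal graphs of
  the latter kind have about \<open>t n\<close> edges. All that is needed is that no \<open>Q n\<close> embeds into a
  later \<open>Q n'\<close> from a different interval. For this \<open>Q n\<close> is a bipartite graph on about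
  \<open>2 m / log m\<close> vertices, where \<open>m = s n\<close>, plus two odd cycles whose lengths encode \<open>m\<close>, and there are
  sufficiently many pairwise non-isomorphic choices of the bipartite part.
\<close>

section \<open>Embeddings of edge sets\<close>

text \<open>The apexes serve two purposes. A set of \<open>t\<close> vertices whose deletion
  destroys all \<open>Q k\<close> forces about \<open>t n\<close> edges in a saturated graph, which
  is too many once \<open>t\<close> exceeds the linear constant of \<open>s\<close>. On the other
  hand \<open>Q n\<close> survives the deletion of any \<open>t\<close> vertices from its own cone,
  so the intended graph does not fall under that alternative once it gains an edge. The numbers
  balance as follows. With \<open>w = m / ln m\<close>, about \<open>m\<close> edges between two
  classes of size \<open>w\<close> can be chosen in at least
  \<open>(w^2 / m)^m = exp (m ln m - 2 m ln ln m)\<close> ways. Passing to incomparable choices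
  divides this by at most \<open>v^v\<close>, where \<open>v = O(m / ln m)\<close>, hence by
  \<open>exp (O(m))\<close>. Apexes and cycles use up \<open>O(m / ln m)\<close> edges, each worth a
  factor of at most \<open>m\<close>, so again only \<open>exp (O(m))\<close> is lost. A single
  cycle whose length encodes \<open>m\<close> injectively would need order \<open>m\<close> vertices
  and break this budget; two lengths taken from a pairing function need only
  \<open>O(sqrt m)\<close>.\<close>

definition embeds :: "'a set set \<Rightarrow> 'b set set \<Rightarrow> bool" where
  "embeds A B \<longleftrightarrow> (\<exists>f. inj_on f (\<Union>A) \<and> (\<forall>e\<in>A. f ` e \<in> B))"

definition edge_set :: "'a set set \<Rightarrow> bool" where
  "edge_set E \<longleftrightarrow> finite E \<and> (\<forall>e\<in>E. card e = 2)"

lemma embeds_refl: "A \<subseteq> B \<Longrightarrow> embeds A B"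
  unfolding embeds_def by (intro exI[of _ id]) auto

lemma embeds_trans:
  assumes "embeds A B" "embeds B C"
  shows "embeds A C"
proof -
  obtain f g where f: "inj_on f (\<Union>A)" "\<forall>e\<in>A. f ` e \<in> B"
    and g: "inj_on g (\<Union>B)" "\<forall>e\<in>B. g ` e \<in> C"
    using assms unfolding embeds_def by blast
  have "f ` \<Union>A \<subseteq> \<Union>B"
    using f(2) by blast
  then have "inj_on (g \<circ> f) (\<Union>A)"
    using f(1) g(1) by (intro comp_inj_on) (auto intro: inj_on_subset)
  moreover have "\<forall>e\<in>A. (g \<circ> f) ` e \<in> C"
    using f(2) g(2) by (metis image_comp)
  ultimately show ?thesis
    unfolding embeds_def by blast
qed

lemma embeds_mono: "embeds A B \<Longrightarrow> A' \<subseteq> A \<Longrightarrow> B \<subseteq> B' \<Longrightarrow> embeds A' B'"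
  by (meson embeds_refl embeds_trans)

lemma inj_on_image_of_edges:
  assumes "inj_on f (\<Union>A)"
  shows "inj_on ((`) f) A"
proof (rule inj_onI)
  fix x y assume "x \<in> A" "y \<in> A" "f ` x = f ` y"
  then show "x = y"
    using assms inj_on_image_eq_iff[OF assms, of x y] by blast
qed

lemma embeds_card_le:
  assumes "embeds A B" "finite B"
  shows "card A \<le> card B"
proof -
  obtain f where f: "inj_on f (\<Union>A)" "\<forall>e\<in>A. f ` e \<in> B"
    using assms unfolding embeds_def by blast
  then show ?thesis
    using assms(2) by (intro card_inj_on_le[OF inj_on_image_of_edges[OF f(1)]]) auto
qed

lemma embeds_image:
  assumes "inj_on f V" "\<Union>A \<subseteq> V"
  shows "embeds A ((`) f ` A)" "embeds ((`) f ` A) A"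
proof -
  show "embeds A ((`) f ` A)"
    unfolding embeds_def using assms by (intro exI[of _ f]) (auto intro: inj_on_subset)
  show "embeds ((`) f ` A) A"
    unfolding embeds_def
  proof (intro exI conjI ballI)
    show "inj_on (inv_into V f) (\<Union>((`) f ` A))"
      using assms by (intro inj_on_inv_into) auto
    fix e assume "e \<in> (`) f ` A"
    then obtain d where d: "d \<in> A" "e = f ` d" by auto
    then have "inv_into V f ` e = d"
      using assms by (metis Sup_upper dual_order.trans inv_into_image_cancel)
    with d show "inv_into V f ` e \<in> A" by simp
  qed
qed

lemma extend_inj_on:
  assumes "finite A" "finite B" "U \<subseteq> A" "inj_on f U" "f ` U \<subseteq> B" "card A \<le> card B"
  obtains g where "inj_on g A" "g ` A \<subseteq> B" "\<And>x. x \<in> U \<Longrightarrow> g x = f x"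
proof -
  have fU: "finite U"
    using assms finite_subset by blast
  have "card (A - U) \<le> card (B - f ` U)"
    using assms fU by (simp add: card_Diff_subset card_image)
  then obtain h where h: "h ` (A - U) \<subseteq> B - f ` U" "inj_on h (A - U)"
    using assms by (meson card_le_inj finite_Diff)
  define g where "g x = (if x \<in> U then f x else h x)" for x
  have "inj_on g A"
  proof (rule inj_onI)
    fix x y assume xy: "x \<in> A" "y \<in> A" "g x = g y"
    show "x = y"
    proof (cases "x \<in> U"; cases "y \<in> U")
      assume "x \<in> U" "y \<in> U" then show ?thesis
        using xy assms(4) by (simp add: g_def inj_on_def)
    next
      assume *: "x \<in> U" "y \<notin> U"
      then have "h y \<notin> f ` U" using h xy by blast
      then show ?thesis using * xy(3) by (metis g_def imageI)
    next
      assume *: "x \<notin> U" "y \<in> U"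
      then have "h x \<notin> f ` U" using h xy by blast
      then show ?thesis using * xy(3) by (metis g_def imageI)
    next
      assume "x \<notin> U" "y \<notin> U" then show ?thesis
        using xy h(2) by (simp add: g_def inj_on_def)
    qed
  qed
  moreover have "g ` A \<subseteq> B"
    using h(1) assms(5) by (auto simp: g_def)
  ultimately show thesis
    using that[of g] by (simp add: g_def)
qed

section \<open>Containment and saturation in terms of edge sets and orders\<close>

lemma simple_graph_iff:
  "simple_graph G \<longleftrightarrow> finite (verts G) \<and> edge_set (edges G) \<and> \<Union>(edges G) \<subseteq> verts G"
proof -
  have "finite (edges G)" if "finite (verts G)" "\<forall>e\<in>edges G. e \<subseteq> verts G"
    by (rule finite_subset[of _ "Pow (verts G)"]) (use that in auto)
  then show ?thesis
    unfolding simple_graph_def edge_set_def by auto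
qed

text \<open>Isolated vertices of \<open>F\<close> only need room: an embedding of the edges extends
  to an injection of all vertices as soon as \<open>G\<close> has enough of them. From here on
  isolated vertices are recorded by a mere number.\<close>

lemma contains_graph_iff:
  fixes G :: "'a graph" and F :: "'b graph"
  assumes G: "simple_graph G" and F: "simple_graph F"
  shows "contains_graph G F \<longleftrightarrow> card (verts F) \<le> card (verts G) \<and> embeds (edges F) (edges G)"
proof (intro iffI conjI; (elim conjE)?)
  assume "contains_graph G F"
  then obtain H f where H: "subgraph H G" and f: "bij_betw f (verts H) (verts F)"
    and iso: "\<forall>u\<in>verts H. \<forall>v\<in>verts H. {u, v} \<in> edges H \<longleftrightarrow> {f u, f v} \<in> edges F"
    unfolding contains_graph_def graph_iso_def by blast
  show "card (verts F) \<le> card (verts G)"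
    using H G bij_betw_same_card[OF f] card_mono[of "verts G" "verts H"]
    by (auto simp: subgraph_def simple_graph_def)
  show "embeds (edges F) (edges G)"
    unfolding embeds_def
  proof (intro exI conjI ballI)
    let ?g = "inv_into (verts H) f"
    have im: "f ` verts H = verts F" and inj: "inj_on f (verts H)"
      using f by (auto simp: bij_betw_def)
    show "inj_on ?g (\<Union>(edges F))"
      using F im by (intro inj_on_inv_into) (auto simp: simple_graph_iff)
    fix e assume e: "e \<in> edges F"
    then obtain x y where xy: "e = {x, y}" "x \<in> verts F" "y \<in> verts F"
      using F by (auto simp: simple_graph_def card_2_iff)
    then obtain u v where uv: "u \<in> verts H" "v \<in> verts H" "f u = x" "f v = y"
      using im by (metis imageE)
    then have "?g ` e = {u, v}"
      using xy inj by (auto simp: inv_into_f_f)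
    then show "?g ` e \<in> edges G"
      using iso uv e xy H by (auto simp: subgraph_def)
  qed
next
  assume le: "card (verts F) \<le> card (verts G)" and "embeds (edges F) (edges G)"
  then obtain f where f: "inj_on f (\<Union>(edges F))" "\<forall>e\<in>edges F. f ` e \<in> edges G"
    unfolding embeds_def by blast
  have "f ` \<Union>(edges F) \<subseteq> verts G"
    using f(2) G by (auto simp: simple_graph_iff)
  then obtain g where g: "inj_on g (verts F)" "g ` verts F \<subseteq> verts G"
    and gf: "\<And>x. x \<in> \<Union>(edges F) \<Longrightarrow> g x = f x"
    using extend_inj_on[of "verts F" "verts G" "\<Union>(edges F)" f] F G f(1) le
    unfolding simple_graph_iff by metis
  have gfe: "g ` e = f ` e" if "e \<in> edges F" for e
    using gf that by (intro image_cong) auto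
  define H where "H = (g ` verts F, (`) g ` edges F)"
  have "simple_graph H"
    unfolding simple_graph_def
  proof (intro conjI ballI)
    show "finite (verts H)"
      using F by (simp add: H_def simple_graph_def)
    fix e assume "e \<in> edges H"
    then obtain d where d: "d \<in> edges F" "e = g ` d"
      by (auto simp: H_def)
    then have "d \<subseteq> verts F" "card d = 2"
      using F by (auto simp: simple_graph_def)
    then show "e \<subseteq> verts H" "card e = 2"
      using d g(1) by (auto simp: H_def card_image inj_on_subset)
  qed
  then have "subgraph H G"
    using g f(2) gfe by (auto simp: subgraph_def H_def)
  moreover have "graph_iso H F"
    unfolding graph_iso_def
  proof (intro exI conjI ballI)
    show b: "bij_betw (inv_into (verts F) g) (verts H) (verts F)"
      using g(1) by (auto simp: H_def intro!: bij_betw_inv_into inj_on_imp_bij_betw)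
    fix u v assume "u \<in> verts H" "v \<in> verts H"
    then obtain x y where xy: "x \<in> verts F" "y \<in> verts F" "u = g x" "v = g y"
      by (auto simp: H_def)
    have "{u, v} \<in> edges H \<longleftrightarrow> {x, y} \<in> edges F"
    proof
      assume "{u, v} \<in> edges H"
      then obtain d where d: "d \<in> edges F" "g ` {x, y} = g ` d"
        using xy by (auto simp: H_def)
      have "d \<subseteq> verts F"
        using d F by (auto simp: simple_graph_def)
      then have "{x, y} = d"
        using inj_on_image_eq_iff[OF g(1), of "{x, y}" d] d xy by auto
      with d show "{x, y} \<in> edges F" by simp
    next
      assume "{x, y} \<in> edges F"
      then have "g ` {x, y} \<in> (`) g ` edges F" by blast
      then show "{u, v} \<in> edges H"
        using xy by (simp add: H_def)
    qed
    then show "{u, v} \<in> edges H \<longleftrightarrow> {inv_into (verts F) g u, inv_into (verts F) g v} \<in> edges F"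
      using xy g(1) by (simp add: inv_into_f_f)
  qed
  ultimately show "contains_graph G F"
    unfolding contains_graph_def by blast
qed

text \<open>The order \<open>n\<close> is kept apart from the edge set because one edge set is
  compared at many orders; enlarging either of the two can only create forbidden subgraphs.\<close>

definition forb :: "nat graph set \<Rightarrow> nat \<Rightarrow> 'a set set \<Rightarrow> bool" where
  "forb \<F> n E \<longleftrightarrow> (\<exists>F\<in>\<F>. card (verts F) \<le> n \<and> embeds (edges F) E)"

lemma forb_mono: "forb \<F> n E \<Longrightarrow> n \<le> n' \<Longrightarrow> embeds E E' \<Longrightarrow> forb \<F> n' E'"
  unfolding forb_def by (meson embeds_trans le_trans)

lemma edge_set_insert: "edge_set E \<Longrightarrow> u \<noteq> v \<Longrightarrow> edge_set (insert {u, v} E)"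
  by (auto simp: edge_set_def)

lemma saturated_iff:
  assumes "graph_family \<F>"
  shows "saturated \<F> G \<longleftrightarrow> simple_graph G \<and> \<not> forb \<F> (card (verts G)) (edges G) \<and>
    (\<forall>u\<in>verts G. \<forall>v\<in>verts G. u \<noteq> v \<and> {u, v} \<notin> edges G \<longrightarrow>
       forb \<F> (card (verts G)) (insert {u, v} (edges G)))"
proof -
  have F: "simple_graph F" if "F \<in> \<F>" for F
    using assms that by (auto simp: graph_family_def)
  have "simple_graph (add_edge G u v)" if "simple_graph G" "u \<in> verts G" "v \<in> verts G" "u \<noteq> v" for u v
    using that by (auto simp: simple_graph_iff add_edge_def edge_set_insert)
  then have add: "(\<exists>F\<in>\<F>. contains_graph (add_edge G u v) F) \<longleftrightarrow>
      forb \<F> (card (verts G)) (insert {u, v} (edges G))"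
    if "simple_graph G" "u \<in> verts G" "v \<in> verts G" "u \<noteq> v" for u v
    using that F unfolding forb_def by (simp add: contains_graph_iff) (simp add: add_edge_def)
  have free: "(\<forall>F\<in>\<F>. \<not> contains_graph G F) \<longleftrightarrow> \<not> forb \<F> (card (verts G)) (edges G)"
    if "simple_graph G"
    using that F unfolding forb_def by (simp add: contains_graph_iff)
  show ?thesis
    unfolding saturated_def by (simp add: add free cong: conj_cong)
qed

lemma sat_attained:
  assumes "graph_family \<F>"
  obtains G :: "nat graph" where "saturated \<F> G" "card (verts G) = n" "card (edges G) = sat n \<F>"
proof -
  obtain G :: "nat graph" where "saturated \<F> G \<and> card (verts G) = n"
    using ex_saturated[OF assms] by blast
  then have "\<exists>m. \<exists>G :: nat graph. saturated \<F> G \<and> card (verts G) = n \<and> card (edges G) = m"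
    by blast
  from LeastI_ex[OF this] show thesis
    using that unfolding sat_def by blast
qed

lemma sat_le:
  fixes G :: "nat graph"
  assumes "saturated \<F> G"
  shows "sat (card (verts G)) \<F> \<le> card (edges G)"
  unfolding sat_def using assms by (intro Least_le) blast

lemma card_Union_edges_le:
  assumes "edge_set E"
  shows "finite (\<Union>E)" "card (\<Union>E) \<le> 2 * card E"
proof -
  have fin: "finite E" "\<And>e. e \<in> E \<Longrightarrow> finite e \<and> card e = 2"
    using assms by (auto simp: edge_set_def intro: card_ge_0_finite)
  then show "finite (\<Union>E)" by auto
  have "card (\<Union>E) \<le> (\<Sum>e\<in>E. card e)"
    using fin by (intro card_Union_le_sum_card)
  also have "\<dots> = 2 * card E"
    using fin by simp
  finally show "card (\<Union>E) \<le> 2 * card E" .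
qed

lemma edge_set_image:
  assumes "edge_set E" "inj_on f V" "\<Union>E \<subseteq> V"
  shows "edge_set ((`) f ` E)" "card ((`) f ` E) = card E"
proof -
  have "card (f ` e) = card e" if "e \<in> E" for e
    using that assms by (intro card_image inj_on_subset[OF assms(2)]) auto
  then show "edge_set ((`) f ` E)"
    using assms by (auto simp: edge_set_def)
  show "card ((`) f ` E) = card E"
    using assms by (intro card_image inj_on_image_of_edges) (auto intro: inj_on_subset)
qed

lemma saturated_image:
  fixes f :: "'a \<Rightarrow> 'b"
  assumes fam: "graph_family \<F>" and sat: "saturated \<F> (V, E)" and f: "inj_on f V"
  shows "saturated \<F> (f ` V, (`) f ` E)"
proof -
  have s: "finite V" "edge_set E" "\<Union>E \<subseteq> V" "\<not> forb \<F> (card V) E"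
    and m: "\<And>u v. u \<in> V \<Longrightarrow> v \<in> V \<Longrightarrow> u \<noteq> v \<Longrightarrow> {u, v} \<notin> E \<Longrightarrow> forb \<F> (card V) (insert {u, v} E)"
    using sat unfolding saturated_iff[OF fam] by (auto simp: simple_graph_iff)
  have "simple_graph (f ` V, (`) f ` E)"
    using s f edge_set_image[of E f V] by (auto simp: simple_graph_iff)
  moreover have "\<not> forb \<F> (card V) ((`) f ` E)"
    using embeds_image(2)[OF f s(3)] s(4) forb_mono by blast
  moreover have "forb \<F> (card V) (insert {x, y} ((`) f ` E))"
    if xy: "x \<in> f ` V" "y \<in> f ` V" "x \<noteq> y" "{x, y} \<notin> (`) f ` E" for x y
  proof -
    obtain u v where uv: "u \<in> V" "v \<in> V" "x = f u" "y = f v"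
      using xy by blast
    have "u \<noteq> v"
      using xy uv by auto
    moreover have "{u, v} \<notin> E"
    proof
      assume "{u, v} \<in> E"
      then have "f ` {u, v} \<in> (`) f ` E" by (rule imageI)
      then show False using xy(4) uv by simp
    qed
    ultimately have "forb \<F> (card V) (insert {u, v} E)"
      using m uv by blast
    moreover have "embeds (insert {u, v} E) ((`) f ` insert {u, v} E)"
      using f s uv by (intro embeds_image(1)[of _ V]) auto
    ultimately show ?thesis
      using forb_mono uv by fastforce
  qed
  ultimately show ?thesis
    unfolding saturated_iff[OF fam] using card_image[OF f] by auto
qed

section \<open>Intervals counted by their left endpoints\<close>

definition starts :: "nat set \<Rightarrow> nat set" where
  "starts S = {n \<in> S. n = 0 \<or> n - 1 \<notin> S}"

lemma ex_start:
  assumes "n \<in> S"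
  obtains x where "x \<in> starts S" "x \<le> n" "{x..n} \<subseteq> S"
proof -
  define x where "x = (LEAST x. {x..n} \<subseteq> S)"
  have ex: "{n..n} \<subseteq> S" using assms by simp
  then have x: "{x..n} \<subseteq> S" "x \<le> n"
    unfolding x_def by (rule LeastI, intro Least_le)
  have "x - 1 \<notin> S" if "x \<noteq> 0"
  proof
    assume "x - 1 \<in> S"
    moreover have "{x - 1..n} = insert (x - 1) {x..n}"
      using x that by auto
    ultimately have "{x - 1..n} \<subseteq> S"
      using x by simp
    then have "x \<le> x - 1"
      unfolding x_def by (rule Least_le)
    with that show False by simp
  qed
  then show thesis
    using that[of x] x by (auto simp: starts_def subset_iff)
qed

text \<open>Two starts \<open>x < y\<close> cannot share an interval, as \<open>y - 1\<close> would
  then belong to \<open>S\<close>. With the converse below, statements about intervals become counts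
  of starts.\<close>

lemma union_of_intervals_starts:
  assumes "union_of_at_most_intervals k (int ` S)"
  shows "finite (starts S)" "card (starts S) \<le> k"
proof -
  obtain \<I> where I: "finite \<I>" "card \<I> \<le> k" "\<forall>I\<in>\<I>. int_interval I" "int ` S = \<Union>\<I>"
    using assms unfolding union_of_at_most_intervals_def by blast
  have "\<exists>I\<in>\<I>. int x \<in> I" if "x \<in> starts S" for x
    using that I(4) by (auto simp: starts_def)
  then obtain c where c: "\<And>x. x \<in> starts S \<Longrightarrow> c x \<in> \<I> \<and> int x \<in> c x"
    by metis
  have *: False if xy: "x \<in> starts S" "y \<in> starts S" "x < y" "c x = c y" for x y
  proof -
    have "int (y - 1) \<in> c x"
    proof -
      have "int_interval (c x)" "int x \<in> c x" "int y \<in> c x"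
        using c[OF xy(1)] c[OF xy(2)] I(3) xy(4) by auto
      moreover have "int x \<le> int (y - 1)" "int (y - 1) \<le> int y"
        using xy(3) by auto
      ultimately show ?thesis
        unfolding int_interval_def by blast
    qed
    then have "int (y - 1) \<in> int ` S"
      using c[OF xy(1)] I(4) by auto
    then have "y - 1 \<in> S"
      by auto
    then show False
      using xy by (auto simp: starts_def)
  qed
  have inj: "inj_on c (starts S)"
    by (intro inj_onI) (metis * linorder_neqE_nat)
  have sub: "c ` starts S \<subseteq> \<I>"
    using c by auto
  show "finite (starts S)"
    using inj sub I(1) inj_on_finite by blast
  show "card (starts S) \<le> k"
    using card_inj_on_le[OF inj sub I(1)] I(2) by simp
qed

lemma union_of_intervals_if_starts:
  assumes "finite (starts S)" "card (starts S) \<le> k"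
  shows "union_of_at_most_intervals k (int ` S)"
proof -
  define r where "r x = int ` {n. x \<le> n \<and> {x..n} \<subseteq> S}" for x
  have "int_interval (r x)" for x
    unfolding int_interval_def
  proof (intro allI impI; elim conjE)
    fix a b c assume *: "a \<le> b" "b \<le> c" "a \<in> r x" "c \<in> r x"
    then obtain a' c' where ac: "a = int a'" "c = int c'" "x \<le> a'" "{x..c'} \<subseteq> S"
      by (auto simp: r_def)
    then have "b = int (nat b)" "x \<le> nat b" "nat b \<le> c'"
      using * by auto
    then show "b \<in> r x"
      unfolding r_def using ac by (intro image_eqI[of _ _ "nat b"]) auto
  qed
  moreover have "int ` S = \<Union>(r ` starts S)"
  proof
    show "int ` S \<subseteq> \<Union>(r ` starts S)"
    proof
      fix y assume "y \<in> int ` S"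
      then obtain n where n: "n \<in> S" "y = int n" by auto
      obtain x where "x \<in> starts S" "x \<le> n" "{x..n} \<subseteq> S"
        using ex_start[OF n(1)] .
      then show "y \<in> \<Union>(r ` starts S)"
        using n unfolding r_def by blast
    qed
    show "\<Union>(r ` starts S) \<subseteq> int ` S"
      by (auto simp: r_def)
  qed
  ultimately show ?thesis
    unfolding union_of_at_most_intervals_def using assms card_image_le[OF assms(1), of r]
    by (intro exI[of _ "r ` starts S"]) auto
qed

section \<open>Linear bound, intervals and constant saturation numbers\<close>

lemma ex_saturated_extension:
  assumes fam: "graph_family \<F>" and V: "finite V"
    and E0: "edge_set E0" "\<Union>E0 \<subseteq> V" "\<not> forb \<F> (card V) E0"
  obtains E where "E0 \<subseteq> E" "saturated \<F> (V, E)"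
proof -
  let ?S = "{E. edge_set E \<and> \<Union>E \<subseteq> V \<and> \<not> forb \<F> (card V) E}"
  have "finite ?S"
    by (rule finite_subset[of _ "Pow (Pow V)"]) (use V in auto)
  moreover have "E0 \<in> ?S"
    using E0 by simp
  ultimately obtain E where E: "E \<in> ?S" "E0 \<subseteq> E" "\<forall>E'\<in>?S. E \<subseteq> E' \<longrightarrow> E = E'"
    using finite_has_maximal2[of ?S E0] by auto
  have "forb \<F> (card V) (insert {u, v} E)"
    if "u \<in> V" "v \<in> V" "u \<noteq> v" "{u, v} \<notin> E" for u v
  proof (rule ccontr)
    assume "\<not> ?thesis"
    then have "insert {u, v} E \<in> ?S"
      using that E(1) edge_set_insert[of E u v] by auto
    then show False
      using E(3) that by blast
  qed
  then have "saturated \<F> (V, E)"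
    unfolding saturated_iff[OF fam] using E(1) V by (simp add: simple_graph_iff)
  with E(2) show thesis
    using that by blast
qed

lemma edge_setE:
  assumes "edge_set E" "e \<in> E" "x \<in> e"
  obtains y where "e = {x, y}" "x \<noteq> y"
  using assms unfolding edge_set_def by (metis card_2_iff doubleton_eq_iff insertE singletonD)

text \<open>The Kaszonyi--Tuza bound: with \<open>u + 1\<close> the least vertex cover number in the family,
  saturating the join of a clique on \<open>u\<close> vertices with an empty graph creates only bounded degrees
  outside that clique.\<close>

lemma sat_linear:
  assumes fam: "graph_family \<F>"
  shows "(\<lambda>n. real (sat n \<F>)) \<in> O(\<lambda>n. real n)"
proof -
  define P where "P k \<longleftrightarrow> (\<exists>F\<in>\<F>. \<exists>S\<subseteq>verts F. card S = k \<and> (\<forall>e\<in>edges F. e \<inter> S \<noteq> {}))" for k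
  have simple: "finite (verts F)" "edge_set (edges F)" "\<Union>(edges F) \<subseteq> verts F" "edges F \<noteq> {}"
    if "F \<in> \<F>" for F
    using fam that by (auto simp: graph_family_def simple_graph_iff)
  obtain F where F: "F \<in> \<F>"
    using fam by (auto simp: graph_family_def)
  have "e \<inter> verts F \<noteq> {}" if e: "e \<in> edges F" for e
  proof -
    have "card e = 2"
      using simple[OF F] e by (auto simp: edge_set_def)
    then have "e \<noteq> {}"
      by auto
    then show ?thesis
      using simple[OF F] e by blast
  qed
  then have "P (card (verts F))"
    unfolding P_def using F by blast
  then have P: "P (Least P)"
    by (rule LeastI)
  then obtain F0 S0 where F0: "F0 \<in> \<F>" and S0: "S0 \<subseteq> verts F0" "card S0 = Least P"
    "\<And>e. e \<in> edges F0 \<Longrightarrow> e \<inter> S0 \<noteq> {}"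
    unfolding P_def by blast
  have finS0: "finite S0"
    using S0(1) simple(1)[OF F0] finite_subset by blast
  have "S0 \<noteq> {}"
    using S0(3) simple(4)[OF F0] by blast
  then obtain u where u: "Least P = Suc u"
    using S0(2) finS0 by (metis card_0_eq not0_implies_Suc)
  define c where "c = card (verts F0)"
  have bound: "sat n \<F> \<le> u * n + n * c" if n: "c \<le> n" for n
  proof -
    define E0 where "E0 = {e. card e = 2 \<and> e \<subseteq> {..<n} \<and> e \<inter> {..<u} \<noteq> {}}"
    have "E0 \<subseteq> Pow {..<n}"
      by (auto simp: E0_def)
    then have "finite E0"
      using finite_subset by blast
    then have E0: "edge_set E0" "\<Union>E0 \<subseteq> {..<n}"
      by (auto simp: edge_set_def E0_def)
    \<comment> \<open>A forbidden graph inside the join would be covered by the at most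
      \<open>u\<close> vertices that land in the clique, below the minimum
      \<open>u + 1\<close>.\<close>
    moreover have "\<not> forb \<F> (card {..<n}) E0"
    proof
      assume "forb \<F> (card {..<n}) E0"
      then obtain F f where F: "F \<in> \<F>" and f: "inj_on f (\<Union>(edges F))"
        "\<And>e. e \<in> edges F \<Longrightarrow> f ` e \<in> E0"
        unfolding forb_def embeds_def by blast
      define S where "S = {x \<in> \<Union>(edges F). f x < u}"
      have "card S \<le> card {..<u}"
        by (rule card_inj_on_le[of f]) (use f(1) in \<open>auto simp: S_def intro: inj_on_subset\<close>)
      moreover have "e \<inter> S \<noteq> {}" if e: "e \<in> edges F" for e
      proof -
        obtain x where "x \<in> e" "f x < u"
          using f(2)[OF e] by (auto simp: E0_def)
        then show ?thesis
          using e by (auto simp: S_def)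
      qed
      moreover have "S \<subseteq> verts F"
        using simple[OF F] by (auto simp: S_def)
      ultimately have "P (card S)" "card S \<le> u"
        unfolding P_def using F by auto
      then show False
        using u Least_le[of P "card S"] by simp
    qed
    ultimately obtain E where E: "E0 \<subseteq> E" "saturated \<F> ({..<n}, E)"
      using ex_saturated_extension[OF fam, of "{..<n}" E0] by auto
    then have E': "edge_set E" "\<Union>E \<subseteq> {..<n}" "\<not> forb \<F> n E"
      unfolding saturated_iff[OF fam] by (auto simp: simple_graph_iff)
    define N where "N v = {w \<in> {u..<n}. {v, w} \<in> E}" for v
    \<comment> \<open>Given \<open>c\<close> neighbours of \<open>v\<close> outside the clique,
      \<open>F0\<close> would embed: its cover \<open>S0\<close> of size \<open>u + 1\<close> goes
      onto the clique together with \<open>v\<close>, and the remaining vertices go into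
      \<open>N v\<close>. Every edge of \<open>F0\<close> meets \<open>S0\<close>, so its image is
      an edge at the clique or an edge at \<open>v\<close>.\<close>
    have N: "card (N v) < c" if v: "v \<in> {u..<n}" for v
    proof (rule ccontr)
      assume "\<not> ?thesis"
      moreover have "card (verts F0 - S0) \<le> c"
        unfolding c_def using simple(1)[OF F0] by (intro card_mono) auto
      ultimately obtain k where k: "k ` (verts F0 - S0) \<subseteq> N v" "inj_on k (verts F0 - S0)"
        using card_le_inj[of "verts F0 - S0" "N v"] simple(1)[OF F0] by (auto simp: N_def)
      have "card (insert v {..<u}) = card S0"
        using v S0(2) u by simp
      then obtain h where h: "bij_betw h S0 (insert v {..<u})"
        using finS0 finite_same_card_bij[of S0 "insert v {..<u}"] by auto
      define g where "g x = (if x \<in> S0 then h x else k x)" for x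
      have gS: "g x = v \<or> g x < u" if "x \<in> S0" for x
        using h that by (auto simp: g_def bij_betw_def)
      have gN: "g x \<in> N v" if "x \<in> verts F0" "x \<notin> S0" for x
        using k(1) that by (auto simp: g_def)
      have vN: "v \<notin> N v"
        using E'(1) by (auto simp: N_def edge_set_def)
      have N_ge: "u \<le> w" if "w \<in> N v" for w
        using that by (auto simp: N_def)
      have injS: "inj_on g S0"
        using h by (auto simp: g_def bij_betw_def inj_on_def)
      have "inj_on g (verts F0)"
      proof (rule inj_onI)
        fix x y assume xy: "x \<in> verts F0" "y \<in> verts F0" "g x = g y"
        have iff: "x \<in> S0 \<longleftrightarrow> y \<in> S0"
          using xy gS gN vN N_ge by (metis leD)
        show "x = y"
        proof (cases "x \<in> S0")
          case True
          then show ?thesis using iff xy injS by (auto simp: inj_on_def)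
        next
          case False
          then show ?thesis using iff xy k(2) by (auto simp: g_def inj_on_def)
        qed
      qed
      have gn: "g ` verts F0 \<subseteq> {..<n}"
        using gS gN v by (fastforce simp: N_def)
      have "g ` e \<in> E" if e: "e \<in> edges F0" for e
      proof -
        obtain x where x: "x \<in> e" "x \<in> S0"
          using S0(3)[OF e] by blast
        then obtain y where y: "e = {x, y}" "x \<noteq> y"
          using edge_setE[OF simple(2)[OF F0] e] by blast
        have eF: "e \<subseteq> verts F0"
          using simple(3)[OF F0] e by blast
        have ne: "g x \<noteq> g y"
          using eF y \<open>inj_on g (verts F0)\<close> by (auto simp: inj_on_def)
        show ?thesis
        proof (cases "g x < u \<or> g y < u")
          case True
          then have "g ` e \<in> E0"
            using y ne gn eF by (auto simp: E0_def)
          then show ?thesis using E(1) by blast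
        next
          case False
          then have "g x = v" "y \<notin> S0"
            using gS x(2) ne by auto
          then have "g y \<in> N v"
            using gN eF y by auto
          then show ?thesis
            using y \<open>g x = v\<close> by (auto simp: N_def)
        qed
      qed
      moreover have "inj_on g (\<Union>(edges F0))"
        using \<open>inj_on g (verts F0)\<close> simple(3)[OF F0] inj_on_subset by blast
      ultimately have "embeds (edges F0) E"
        unfolding embeds_def by blast
      then show False
        using E'(3) F0 n unfolding forb_def c_def by blast
    qed
    have finN: "finite (N v)" for v
      by (simp add: N_def)
    define pair where "pair = (\<lambda>(x, y). {x, y} :: nat set)"
    have "E \<subseteq> pair ` ({..<u} \<times> {..<n}) \<union> pair ` (SIGMA v:{u..<n}. N v)"
    proof
      fix e assume e: "e \<in> E"
      then obtain x y where xy: "e = {x, y}"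
        using E'(1) by (auto simp: edge_set_def card_2_iff)
      then have lt: "x < n" "y < n"
        using E'(2) e by auto
      have "e = pair (x, y)" "e = pair (y, x)"
        using xy by (auto simp: pair_def)
      moreover have "(x, y) \<in> {..<u} \<times> {..<n} \<or> (y, x) \<in> {..<u} \<times> {..<n}
          \<or> (x, y) \<in> (SIGMA v:{u..<n}. N v)"
        using lt e xy by (auto simp: N_def)
      ultimately show "e \<in> pair ` ({..<u} \<times> {..<n}) \<union> pair ` (SIGMA v:{u..<n}. N v)"
        by (metis UnI1 UnI2 imageI)
    qed
    then have "card E \<le> card (pair ` ({..<u} \<times> {..<n}) \<union> pair ` (SIGMA v:{u..<n}. N v))"
      using finN by (intro card_mono) auto
    also have "\<dots> \<le> card (pair ` ({..<u} \<times> {..<n})) + card (pair ` (SIGMA v:{u..<n}. N v))"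
      by (rule card_Un_le)
    also have "\<dots> \<le> card ({..<u} \<times> {..<n}) + card (SIGMA v:{u..<n}. N v)"
      using finN by (intro add_mono card_image_le) auto
    also have "\<dots> = u * n + (\<Sum>v\<in>{u..<n}. card (N v))"
      using finN by simp
    also have "\<dots> \<le> u * n + n * c"
    proof -
      have "(\<Sum>v\<in>{u..<n}. card (N v)) \<le> (\<Sum>v\<in>{u..<n}. c)"
        using N less_imp_le by (intro sum_mono) blast
      also have "\<dots> \<le> n * c"
        by simp
      finally show ?thesis by simp
    qed
    finally have "card E \<le> u * n + n * c" .
    then show ?thesis
      using sat_le[OF E(2)] by simp
  qed
  show ?thesis
  proof (rule bigoI[of _ "real (u + c)"])
    show "\<forall>\<^sub>F n in sequentially. norm (real (sat n \<F>)) \<le> real (u + c) * norm (real n)"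
      using eventually_ge_at_top[of c]
    proof eventually_elim
      case (elim n)
      then have "real (sat n \<F>) \<le> real (u * n + n * c)"
        using bound of_nat_le_iff by blast
      then show ?case
        by (simp add: algebra_simps)
    qed
  qed
qed

section \<open>The number of intervals of a level\<close>

definition sat_sizes :: "nat graph set \<Rightarrow> nat set set \<Rightarrow> nat set" where
  "sat_sizes \<F> E = {n. \<exists>V. card V = n \<and> saturated \<F> (V, E)}"

text \<open>Avoiding the family passes to smaller orders, and creating a forbidden graph by an edge
  passes to larger ones, so only new kinds of non-edges could spoil saturation between
  \<open>x\<close> and \<open>z\<close>. Two isolated vertices at order \<open>x\<close> already
  exhibit every kind: none, one or both ends isolated.\<close>

lemma sat_sizes_convex:
  assumes fam: "graph_family \<F>" and x: "x \<in> sat_sizes \<F> E" and z: "z \<in> sat_sizes \<F> E"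
    and le: "card (\<Union>E) + 2 \<le> x" "x \<le> y" "y \<le> z"
  shows "y \<in> sat_sizes \<F> E"
proof -
  obtain V where V: "card V = x" "saturated \<F> (V, E)"
    using x by (auto simp: sat_sizes_def)
  obtain V' where V': "card V' = z" "saturated \<F> (V', E)"
    using z by (auto simp: sat_sizes_def)
  have E: "finite V" "edge_set E" "\<Union>E \<subseteq> V"
    and sat: "\<And>u v. u \<in> V \<Longrightarrow> v \<in> V \<Longrightarrow> u \<noteq> v \<Longrightarrow> {u, v} \<notin> E \<Longrightarrow> forb \<F> x (insert {u, v} E)"
    using V unfolding saturated_iff[OF fam] by (auto simp: simple_graph_iff)
  have "finite V'" "\<Union>E \<subseteq> V'" and free: "\<not> forb \<F> z E"
    using V' unfolding saturated_iff[OF fam] by (auto simp: simple_graph_iff)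
  moreover have "card (\<Union>E) \<le> y"
    using le by simp
  ultimately obtain W where W: "\<Union>E \<subseteq> W" "card W = y" "finite W"
    using exists_subset_between[of "\<Union>E" y V'] V'(1) le by (metis finite_subset)
  have "forb \<F> y (insert {u, v} E)"
    if uv: "u \<in> W" "v \<in> W" "u \<noteq> v" "{u, v} \<notin> E" for u v
  proof -
    let ?U = "insert u (insert v (\<Union>E))"
    have finU: "finite (\<Union>E)"
      using E finite_subset by blast
    have "card ?U \<le> card V"
      using le V(1) card_insert_le_m1[of 1] finU by (auto simp: card_insert_if)
    \<comment> \<open>\<open>g\<close> fixes all covered vertices and moves only isolated ends of
      the pair into \<open>V\<close>, so a non-edge stays a non-edge.\<close>
    then obtain g where g: "inj_on g ?U" "g ` ?U \<subseteq> V" "\<And>a. a \<in> \<Union>E \<Longrightarrow> g a = a"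
      using extend_inj_on[of ?U V "\<Union>E" id] finU E by auto
    have "(`) g ` E = E"
    proof -
      have "g ` e = e" if "e \<in> E" for e
      proof -
        have "g ` e = id ` e"
          using g(3) that by (intro image_cong) auto
        then show ?thesis by simp
      qed
      then show ?thesis by simp
    qed
    then have im: "(`) g ` insert {u, v} E = insert {g u, g v} E"
      by simp
    have emb: "embeds (insert {g u, g v} E) (insert {u, v} E)"
      using embeds_image(2)[OF g(1), of "insert {u, v} E"] unfolding im by auto
    have "g u \<noteq> g v"
      using g(1) uv(3) by (auto simp: inj_on_def)
    moreover have "{g u, g v} \<notin> E"
    proof
      assume e: "{g u, g v} \<in> E"
      then have gE: "g u \<in> \<Union>E" "g v \<in> \<Union>E"
        by blast+
      then have "g (g u) = g u" "g (g v) = g v" "g u \<in> ?U" "g v \<in> ?U"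
        using g(3) by blast+
      then have "g u = u" "g v = v"
        using g(1) by (meson inj_onD insertI1 insertI2)+
      then show False
        using e uv(4) by simp
    qed
    ultimately have "forb \<F> x (insert {g u, g v} E)"
      using sat g(2) by auto
    then show ?thesis
      using forb_mono le(2) emb by blast
  qed
  moreover have "\<not> forb \<F> y E"
    using free le(3) forb_mono embeds_refl by blast
  ultimately have "saturated \<F> (W, E)"
    unfolding saturated_iff[OF fam] using W E by (simp add: simple_graph_iff)
  then show ?thesis
    using W(2) by (auto simp: sat_sizes_def)
qed

lemma card_le_4:
  fixes A :: "nat set"
  assumes "\<And>x y. x \<in> A \<Longrightarrow> y \<in> A \<Longrightarrow> p + 3 \<le> x \<Longrightarrow> x < y \<Longrightarrow> False"
    and "\<And>x. x \<in> A \<Longrightarrow> p \<le> x"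
  shows "finite A" "card A \<le> 4"
proof -
  have "\<exists>z. A \<subseteq> {p, p + 1, p + 2, z}"
  proof (cases "\<exists>z\<in>A. p + 3 \<le> z")
    case True
    then obtain z where z: "z \<in> A" "p + 3 \<le> z" by blast
    have "y \<in> {p, p + 1, p + 2, z}" if "y \<in> A" for y
      using assms(1)[of y z] assms(1)[of z y] assms(2)[of y] that z
      by (cases "p + 3 \<le> y"; cases y z rule: linorder_cases) auto
    then show ?thesis by blast
  next
    case False
    then have "A \<subseteq> {p, p + 1, p + 2, p}"
      using assms(2) by (force simp: not_le)
    then show ?thesis by blast
  qed
  then obtain z where z: "A \<subseteq> {p, p + 1, p + 2, z}" by blast
  then show "finite A"
    using finite_subset by blast
  have "card A \<le> card {p, p + 1, p + 2, z}"
    using z by (intro card_mono) auto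
  also have "\<dots> \<le> 4"
    by (simp add: card_insert_if)
  finally show "card A \<le> 4" .
qed

definition ends :: "nat set \<Rightarrow> nat set" where
  "ends S = {n \<in> S. Suc n \<notin> S}"

text \<open>No order below \<open>?p\<close> occurs, and from \<open>?p + 2\<close> on the orders
  form one interval. This leaves \<open>?p\<close>, \<open>?p + 1\<close>, \<open>?p + 2\<close> and
  a single later point as possible starts or ends.\<close>

lemma sat_sizes_starts_ends:
  assumes fam: "graph_family \<F>"
  shows "finite (starts (sat_sizes \<F> E))" "card (starts (sat_sizes \<F> E)) \<le> 4"
    "finite (ends (sat_sizes \<F> E))" "card (ends (sat_sizes \<F> E)) \<le> 4"
proof -
  let ?p = "card (\<Union>E)"
  have ge: "?p \<le> x" if "x \<in> sat_sizes \<F> E" for x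
    using that unfolding sat_sizes_def saturated_iff[OF fam]
    by (auto simp: simple_graph_iff intro: card_mono)
  have conv: "z \<in> sat_sizes \<F> E"
    if "x \<in> sat_sizes \<F> E" "y \<in> sat_sizes \<F> E" "?p + 2 \<le> x" "x \<le> z" "z \<le> y" for x y z
    using sat_sizes_convex[OF fam] that by blast
  have s: False if "x \<in> starts (sat_sizes \<F> E)" "y \<in> starts (sat_sizes \<F> E)" "?p + 3 \<le> x" "x < y" for x y
  proof -
    have "x \<le> y - 1"
      using that(4) by simp
    then show False
      using conv[of x y "y - 1"] that by (auto simp: starts_def)
  qed
  have e: False if "x \<in> ends (sat_sizes \<F> E)" "y \<in> ends (sat_sizes \<F> E)" "?p + 3 \<le> x" "x < y" for x y
    using conv[of x y "Suc x"] that by (auto simp: ends_def)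
  show "finite (starts (sat_sizes \<F> E))" "card (starts (sat_sizes \<F> E)) \<le> 4"
    using card_le_4[of "starts (sat_sizes \<F> E)" ?p] s ge by (auto simp: starts_def)
  show "finite (ends (sat_sizes \<F> E))" "card (ends (sat_sizes \<F> E)) \<le> 4"
    using card_le_4[of "ends (sat_sizes \<F> E)" ?p] e ge by (auto simp: ends_def)
qed

text \<open>A graph with \<open>k\<close> edges covers at most \<open>2 * k\<close> vertices, so
  \<open>edge_sets_on (2 * k) k\<close> represents all of them up to isolated vertices. Counting
  labelled graphs is good enough: there are at most \<open>(6 * k) ^ k\<close> of them.\<close>

definition edge_sets_on :: "nat \<Rightarrow> nat \<Rightarrow> nat set set set" where
  "edge_sets_on n k = {E. E \<subseteq> {e. e \<subseteq> {..<n} \<and> card e = 2} \<and> card E = k}"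

lemma finite_edge_sets_on: "finite (edge_sets_on n k)"
  by (rule finite_subset[of _ "Pow (Pow {..<n})"]) (auto simp: edge_sets_on_def)

lemma edge_sets_onD: "E \<in> edge_sets_on n k \<Longrightarrow> edge_set E \<and> \<Union>E \<subseteq> {..<n} \<and> card E = k"
  using finite_subset[of E "Pow {..<n}"] by (auto simp: edge_sets_on_def edge_set_def)

lemma card_edge_sets_on: "card (edge_sets_on n k) = (n choose 2) choose k"
proof -
  have "finite {e. e \<subseteq> {..<n} \<and> card e = 2}"
    by (rule finite_subset[of _ "Pow {..<n}"]) auto
  then show ?thesis
    unfolding edge_sets_on_def by (simp add: n_subsets)
qed

lemma relabel_edges:
  assumes "edge_set E" "2 * card E \<le> n"
  obtains f where "inj_on f (\<Union>E)" "(`) f ` E \<in> edge_sets_on n (card E)"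
proof -
  have fin: "finite (\<Union>E)" "card (\<Union>E) \<le> card {..<n}"
    using card_Union_edges_le[OF assms(1)] assms(2) by auto
  then obtain f where f: "f ` \<Union>E \<subseteq> {..<n}" "inj_on f (\<Union>E)"
    using card_le_inj[of "\<Union>E" "{..<n}"] by auto
  have "edge_set ((`) f ` E)" "card ((`) f ` E) = card E"
    using edge_set_image[OF assms(1) f(2)] by auto
  then have "(`) f ` E \<in> edge_sets_on n (card E)"
    using f(1) by (auto simp: edge_sets_on_def edge_set_def)
  then show thesis
    using that f(2) by blast
qed

lemma sat_sizes_witness:
  assumes fam: "graph_family \<F>"
  obtains E where "E \<in> edge_sets_on (2 * sat n \<F>) (sat n \<F>)" "n \<in> sat_sizes \<F> E"
proof -
  obtain G :: "nat graph" where G: "saturated \<F> G" "card (verts G) = n" "card (edges G) = sat n \<F>"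
    using sat_attained[OF fam] .
  then have s: "finite (verts G)" "edge_set (edges G)" "\<Union>(edges G) \<subseteq> verts G"
    by (auto simp: saturated_def simple_graph_iff)
  obtain f where f: "inj_on f (\<Union>(edges G))"
    "(`) f ` edges G \<in> edge_sets_on (2 * sat n \<F>) (sat n \<F>)"
    using relabel_edges[OF s(2), of "2 * sat n \<F>"] unfolding G(3) by blast
  define B where "B = f ` \<Union>(edges G) \<union> {..<n}"
  have finB: "finite B"
    using finite_subset[OF s(3,1)] by (simp add: B_def)
  then have "card {..<n} \<le> card B"
    by (intro card_mono) (auto simp: B_def)
  then have "card (verts G) \<le> card B" "f ` \<Union>(edges G) \<subseteq> B"
    using G(2) by (auto simp: B_def)
  then obtain g where g: "inj_on g (verts G)" "\<And>x. x \<in> \<Union>(edges G) \<Longrightarrow> g x = f x"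
    using extend_inj_on[of "verts G" B "\<Union>(edges G)" f] s f(1) finB by metis
  have "g ` e = f ` e" if "e \<in> edges G" for e
    using g(2) that by (intro image_cong) auto
  then have "(`) g ` edges G = (`) f ` edges G"
    by (meson image_cong)
  moreover have "saturated \<F> (g ` verts G, (`) g ` edges G)"
    using saturated_image[OF fam, of "verts G" "edges G" g] G(1) g(1) by simp
  ultimately have "n \<in> sat_sizes \<F> ((`) f ` edges G)"
    unfolding sat_sizes_def using card_image[OF g(1)] G(2) by auto
  then show thesis
    using that f(2) by blast
qed

text \<open>If the level \<open>m\<close> is entered at order \<open>n\<close> from a higher value,
  some graph with \<open>m\<close> edges has just become saturated. If it is entered from a lower
  value \<open>k\<close>, an optimal graph with \<open>k\<close> edges has just ceased to be
  saturated. So every start is charged to a start or an end belonging to a graph with at most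
  \<open>m\<close> edges, at most 4 + 4 per graph.\<close>

lemma sat_level_starts:
  assumes fam: "graph_family \<F>"
  shows "finite (starts {n. sat n \<F> = m})"
    "card (starts {n. sat n \<F> = m}) \<le> 8 * (\<Sum>k\<le>m. (2 * k choose 2) choose k)"
proof -
  define H where "H = (\<Union>k\<in>{..m}. edge_sets_on (2 * k) k)"
  have finH: "finite H"
    by (auto simp: H_def finite_edge_sets_on)
  have le: "sat n \<F> \<le> k" if "E \<in> edge_sets_on (2 * k) k" "n \<in> sat_sizes \<F> E" for E n k
    using that edge_sets_onD[OF that(1)] sat_le unfolding sat_sizes_def by fastforce
  define X where "X = (\<Union>E\<in>H. starts (sat_sizes \<F> E)) \<union> (\<Union>E\<in>H. Suc ` ends (sat_sizes \<F> E))"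
  have sub: "starts {n. sat n \<F> = m} \<subseteq> X"
  proof
    fix n assume "n \<in> starts {n. sat n \<F> = m}"
    then have n: "sat n \<F> = m" "n = 0 \<or> sat (n - 1) \<F> \<noteq> m"
      by (auto simp: starts_def)
    obtain E where E: "E \<in> edge_sets_on (2 * m) m" "n \<in> sat_sizes \<F> E"
      using sat_sizes_witness[OF fam, of n] n(1) by metis
    then have "E \<in> H"
      by (auto simp: H_def)
    show "n \<in> X"
    proof (cases "n = 0 \<or> m < sat (n - 1) \<F>")
      case True
      then have "n \<in> starts (sat_sizes \<F> E)"
        using E le[OF E(1), of "n - 1"] by (auto simp: starts_def)
      then show ?thesis
        using \<open>E \<in> H\<close> by (auto simp: X_def)
    next
      case False
      define k where "k = sat (n - 1) \<F>"
      have k: "k < m" "n = Suc (n - 1)"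
        using False n(2) by (auto simp: k_def)
      obtain D where D: "D \<in> edge_sets_on (2 * k) k" "n - 1 \<in> sat_sizes \<F> D"
        using sat_sizes_witness[OF fam, of "n - 1"] k_def by metis
      then have "n \<notin> sat_sizes \<F> D"
        using le[OF D(1), of n] k(1) n(1) by auto
      then have "n - 1 \<in> ends (sat_sizes \<F> D)"
        using D k(2) by (auto simp: ends_def)
      moreover have "D \<in> H"
        using D(1) k(1) by (auto simp: H_def)
      ultimately show ?thesis
        using k(2) unfolding X_def by blast
    qed
  qed
  have finX: "finite X"
    using finH sat_sizes_starts_ends[OF fam] by (auto simp: X_def)
  show "finite (starts {n. sat n \<F> = m})"
    using sub finX finite_subset by blast
  have "card (starts {n. sat n \<F> = m}) \<le> card X"
    using sub finX card_mono by blast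
  also have "\<dots> \<le> card (\<Union>E\<in>H. starts (sat_sizes \<F> E)) + card (\<Union>E\<in>H. Suc ` ends (sat_sizes \<F> E))"
    unfolding X_def by (rule card_Un_le)
  also have "\<dots> \<le> (\<Sum>E\<in>H. card (starts (sat_sizes \<F> E))) + (\<Sum>E\<in>H. card (Suc ` ends (sat_sizes \<F> E)))"
    using finH by (intro add_mono card_UN_le)
  also have "\<dots> \<le> (\<Sum>E\<in>H. 4) + (\<Sum>E\<in>H. 4)"
    using sat_sizes_starts_ends[OF fam] by (intro add_mono sum_mono) (auto simp: card_image)
  also have "\<dots> = 8 * card H"
    by simp
  finally have "card (starts {n. sat n \<F> = m}) \<le> 8 * card H" .
  moreover have "card H \<le> (\<Sum>k\<le>m. card (edge_sets_on (2 * k) k))"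
    unfolding H_def by (rule card_UN_le) simp
  ultimately show "card (starts {n. sat n \<F> = m}) \<le> 8 * (\<Sum>k\<le>m. (2 * k choose 2) choose k)"
    unfolding card_edge_sets_on by linarith
qed

section \<open>The dichotomy\<close>

lemma cofinite_if_infinite_starts:
  assumes "finite (starts S)" "infinite S"
  shows "\<forall>\<^sub>F n in sequentially. n \<in> S"
proof -
  obtain b where b: "\<forall>x\<in>starts S. x < b"
    using assms(1) unfolding finite_nat_set_iff_bounded by blast
  \<comment> \<open>No run begins at \<open>b\<close> or later, so the run through any element of
    \<open>S\<close> beyond \<open>b\<close> covers everything from \<open>b\<close> up to
    it.\<close>
  have "n \<in> S" if "b \<le> n" for n
  proof -
    obtain n' where "n' \<in> S" "n \<le> n'"
      using assms(2) unfolding finite_nat_set_iff_bounded by (meson not_le)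
    moreover obtain x where "x \<in> starts S" "{x..n'} \<subseteq> S"
      using ex_start[OF \<open>n' \<in> S\<close>] by blast
    moreover have "x < n"
      using b \<open>x \<in> starts S\<close> that by force
    ultimately show ?thesis
      by auto
  qed
  then show ?thesis
    unfolding eventually_sequentially by blast
qed

lemma sat_dichotomy:
  assumes "graph_family \<F>"
  shows "filterlim (\<lambda>n. sat n \<F>) at_top sequentially \<or> (\<exists>c. \<forall>\<^sub>F n in sequentially. sat n \<F> = c)"
proof (cases "\<exists>m. infinite {n. sat n \<F> = m}")
  case True
  then show ?thesis
    using cofinite_if_infinite_starts sat_level_starts(1)[OF assms] by fastforce
next
  case False
  have "\<forall>\<^sub>F n in sequentially. Z \<le> sat n \<F>" for Z
  proof -
    have "{n. sat n \<F> < Z} = (\<Union>m<Z. {n. sat n \<F> = m})"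
      by auto
    then have "finite {n. sat n \<F> < Z}"
      using False by auto
    then obtain b where "\<forall>n\<in>{n. sat n \<F> < Z}. n < b"
      unfolding finite_nat_set_iff_bounded by blast
    then show ?thesis
      unfolding eventually_sequentially by (intro exI[of _ b]) (auto simp: not_le[symmetric])
  qed
  then show ?thesis
    by (simp add: filterlim_at_top)
qed

section \<open>Constant saturation numbers\<close>

lemma ex_nonedge:
  assumes "finite V" "card E < card V choose 2" "finite E"
  obtains u v where "u \<in> V" "v \<in> V" "u \<noteq> v" "{u, v} \<notin> E"
proof -
  have "card {e. e \<subseteq> V \<and> card e = 2} = card V choose 2"
    using n_subsets[OF assms(1)] by simp
  then have "\<not> {e. e \<subseteq> V \<and> card e = 2} \<subseteq> E"
    using assms card_mono[of E] by (metis leD)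
  then obtain e where "e \<subseteq> V" "card e = 2" "e \<notin> E" by blast
  then show thesis
    using that by (auto simp: card_2_iff)
qed

text \<open>The family consists of the graphs with \<open>m + 1\<close> edges, for which
  \<open>2 * m + 2\<close> vertices are enough. Freeness then means at most \<open>m\<close> edges.
  Saturation forces exactly \<open>m\<close>, because at orders from \<open>N\<close> on a graph
  with at most \<open>m\<close> edges still has a non-edge.\<close>

lemma ex_constant_sat:
  "\<exists>\<F>. graph_family \<F> \<and> finite \<F> \<and> (\<forall>\<^sub>F n in sequentially. sat n \<F> = m)"
proof -
  define N where "N = 2 * m + 2"
  define \<F> where "\<F> = (\<lambda>E. ({..<N}, E)) ` edge_sets_on N (Suc m)"
  have choose: "m < n choose 2" if "N \<le> n" for n
  proof -
    have "2 * m + 2 \<le> n"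
      using that by (simp add: N_def)
    then have "(2 * m + 2) * 1 \<le> n * (n - 1)"
      by (intro mult_le_mono) auto
    then show ?thesis
      by (simp add: choose_two)
  qed
  have "Suc m \<le> N choose 2"
    using choose[of N] by simp
  then have "0 < card (edge_sets_on N (Suc m))"
    by (simp add: card_edge_sets_on)
  then have "edge_sets_on N (Suc m) \<noteq> {}"
    by fastforce
  moreover have "simple_graph ({..<N}, E) \<and> card E \<ge> 1" if "E \<in> edge_sets_on N (Suc m)" for E
    using edge_sets_onD[OF that] by (simp add: simple_graph_iff)
  ultimately have fam: "graph_family \<F>"
    by (auto simp: graph_family_def \<F>_def)
  have forb: "forb \<F> n E \<longleftrightarrow> Suc m \<le> card E" if n: "N \<le> n" and E: "edge_set E"
    for n and E :: "nat set set"
  proof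
    assume "forb \<F> n E"
    then obtain D where "D \<in> edge_sets_on N (Suc m)" "embeds D E"
      by (auto simp: forb_def \<F>_def)
    then show "Suc m \<le> card E"
      using embeds_card_le edge_sets_onD E unfolding edge_set_def by metis
  next
    assume "Suc m \<le> card E"
    then obtain D where D: "D \<subseteq> E" "card D = Suc m" "finite D"
      by (meson obtain_subset_with_card_n)
    then have "edge_set D"
      using E by (auto simp: edge_set_def)
    then obtain f where f: "inj_on f (\<Union>D)" "(`) f ` D \<in> edge_sets_on N (Suc m)"
      using relabel_edges[of D N] D(2) by (auto simp: N_def)
    moreover have "embeds ((`) f ` D) E"
      using embeds_image(2)[OF f(1)] D(1) embeds_refl embeds_trans by blast
    ultimately show "forb \<F> n E"
      unfolding forb_def \<F>_def using n by (auto intro!: bexI[of _ "(`) f ` D"])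
  qed
  have "sat n \<F> = m" if n: "N \<le> n" for n
  proof -
    obtain G :: "nat graph" where G: "saturated \<F> G" "card (verts G) = n" "card (edges G) = sat n \<F>"
      using sat_attained[OF fam] .
    then have s: "finite (verts G)" "edge_set (edges G)" "\<not> forb \<F> n (edges G)"
      and max: "\<And>u v. u \<in> verts G \<Longrightarrow> v \<in> verts G \<Longrightarrow> u \<noteq> v \<Longrightarrow> {u, v} \<notin> edges G \<Longrightarrow>
        forb \<F> n (insert {u, v} (edges G))"
      unfolding saturated_iff[OF fam] by (auto simp: simple_graph_iff)
    then have le: "card (edges G) \<le> m"
      using forb[OF n] by simp
    have fin: "finite (edges G)"
      using s(2) by (simp add: edge_set_def)
    obtain u v where uv: "u \<in> verts G" "v \<in> verts G" "u \<noteq> v" "{u, v} \<notin> edges G"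
      using ex_nonedge[OF s(1) _ fin] choose[OF n] le G(2) by (metis le_less_trans)
    then have "Suc m \<le> card (insert {u, v} (edges G))"
      using max forb[OF n] edge_set_insert[OF s(2)] by blast
    then show ?thesis
      using le G(3) uv(4) fin by simp
  qed
  then show ?thesis
    using fam finite_edge_sets_on unfolding eventually_sequentially
    by (intro exI[of _ \<F>]) (auto simp: \<F>_def)
qed

section \<open>Families with prescribed saturation numbers\<close>

definition del_verts :: "'a set set \<Rightarrow> 'a set \<Rightarrow> 'a set set" where
  "del_verts E S = {e \<in> E. e \<inter> S = {}}"

text \<open>For \<open>Q\<close> on \<open>{..<v}\<close> these edges complete \<open>Q\<close> to
  its join with a clique on the apexes \<open>v, ..., v + t - 1\<close>.\<close>

definition apex_edges :: "nat \<Rightarrow> nat \<Rightarrow> nat set set" where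
  "apex_edges v t = {e. card e = 2 \<and> e \<subseteq> {..<v + t} \<and> \<not> e \<subseteq> {..<v}}"

definition cone :: "nat \<Rightarrow> nat \<Rightarrow> nat set set \<Rightarrow> nat set set" where
  "cone v t Q = Q \<union> apex_edges v t"

lemma edge_set_cone:
  assumes "edge_set Q" "\<Union>Q \<subseteq> {..<v}"
  shows "edge_set (cone v t Q)" "\<Union>(cone v t Q) \<subseteq> {..<v + t}"
proof -
  have "finite (apex_edges v t)"
    by (rule finite_subset[of _ "Pow {..<v + t}"]) (auto simp: apex_edges_def)
  then show "edge_set (cone v t Q)"
    using assms by (auto simp: edge_set_def cone_def apex_edges_def)
  show "\<Union>(cone v t Q) \<subseteq> {..<v + t}"
    using assms(2) by (fastforce simp: cone_def apex_edges_def)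
qed

lemma card_cone:
  assumes "edge_set Q" "\<Union>Q \<subseteq> {..<v}"
  shows "card (cone v t Q) = card Q + card (apex_edges v t)"
proof -
  have "finite (apex_edges v t)"
    by (rule finite_subset[of _ "Pow {..<v + t}"]) (auto simp: apex_edges_def)
  then show ?thesis
    unfolding cone_def using assms by (intro card_Un_disjoint) (auto simp: edge_set_def apex_edges_def)
qed

lemma card_apex_edges_le: "card (apex_edges v t) \<le> t * (v + t)"
proof -
  have "apex_edges v t \<subseteq> (\<lambda>(x, y). {x, y}) ` ({v..<v + t} \<times> {..<v + t})"
  proof
    fix e assume e: "e \<in> apex_edges v t"
    then obtain x where x: "x \<in> e" "v \<le> x"
      by (force simp: apex_edges_def)
    obtain y where y: "e = {x, y}"
      using e x(1) unfolding apex_edges_def card_2_iff by auto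
    then have "(x, y) \<in> {v..<v + t} \<times> {..<v + t}"
      using e x by (auto simp: apex_edges_def)
    then show "e \<in> (\<lambda>(x, y). {x, y}) ` ({v..<v + t} \<times> {..<v + t})"
      using y by (auto intro: image_eqI[of _ _ "(x, y)"])
  qed
  then have "card (apex_edges v t) \<le> card ((\<lambda>(x, y). {x, y}) ` ({v..<v + t} \<times> {..<v + t}))"
    by (intro card_mono) auto
  also have "\<dots> \<le> card ({v..<v + t} \<times> {..<v + t})"
    by (rule card_image_le) simp
  finally show ?thesis by simp
qed

text \<open>Deleted vertices of \<open>Q\<close> can be replaced by surviving apexes, which are adjacent to everything.\<close>

lemma embeds_del_verts_cone:
  assumes Q: "edge_set Q" "\<Union>Q \<subseteq> {..<v}" and S: "finite S" "card S \<le> t"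
  shows "embeds Q (del_verts (cone v t Q) S)"
proof -
  let ?A = "S \<inter> {..<v}" and ?T = "{v..<v + t}"
  have "card ?A + card (S \<inter> ?T) = card (?A \<union> (S \<inter> ?T))"
    using S(1) by (intro card_Un_disjoint[symmetric]) auto
  also have "\<dots> \<le> card S"
    using S(1) by (intro card_mono) auto
  finally have "card ?A + card (S \<inter> ?T) \<le> t"
    using S(2) by simp
  moreover have "card (?T - S) = t - card (S \<inter> ?T)"
    using S(1) card_Diff_subset_Int[of ?T S] by (simp add: Int_commute)
  \<comment> \<open>\<open>S\<close> has at most \<open>t\<close> elements and there are
    \<open>t\<close> apexes, so at least as many apexes survive as vertices below \<open>v\<close>
    are deleted.\<close>
  ultimately have "card ?A \<le> card (?T - S)"
    by simp
  then obtain g where g: "g ` ?A \<subseteq> ?T - S" "inj_on g ?A"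
    using card_le_inj[of ?A "?T - S"] by auto
  define h where "h x = (if x \<in> S then g x else x)" for x
  have hS: "h x \<notin> S" "h x < v + t" "x \<in> S \<longleftrightarrow> v \<le> h x" if x: "x < v" for x
  proof -
    have "h x \<notin> S \<and> h x < v + t \<and> (x \<in> S \<longleftrightarrow> v \<le> h x)"
    proof (cases "x \<in> S")
      case True
      then have "g x \<in> ?T - S"
        using g(1) x by blast
      then show ?thesis
        using True by (simp add: h_def)
    qed (use x in \<open>simp add: h_def\<close>)
    then show "h x \<notin> S" "h x < v + t" "x \<in> S \<longleftrightarrow> v \<le> h x"
      by blast+
  qed
  have inj: "inj_on h {..<v}"
  proof (rule inj_onI)
    fix x y assume xy: "x \<in> {..<v}" "y \<in> {..<v}" "h x = h y"
    then have "x \<in> S \<longleftrightarrow> y \<in> S"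
      using hS(3) by (metis lessThan_iff)
    then show "x = y"
      using xy g(2) by (auto simp: h_def inj_on_def split: if_splits)
  qed
  have "h ` e \<in> del_verts (cone v t Q) S" if e: "e \<in> Q" for e
  proof -
    have ev: "e \<subseteq> {..<v}"
      using Q(2) e by blast
    have c: "card (h ` e) = 2"
      using card_image[OF inj_on_subset[OF inj ev]] Q(1) e by (auto simp: edge_set_def)
    have "h ` e \<in> cone v t Q"
    proof (cases "e \<inter> S = {}")
      case True
      then have "h ` e = e"
        by (force simp: h_def)
      then show ?thesis using e by (simp add: cone_def)
    next
      case False
      then obtain x where "x \<in> e" "x \<in> S" by blast
      moreover have "x < v"
        using \<open>x \<in> e\<close> ev by blast
      ultimately have "\<not> h ` e \<subseteq> {..<v}"
        using hS(3)[of x] by force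
      then show ?thesis
        using c hS(2) ev by (auto simp: cone_def apex_edges_def)
    qed
    moreover have "h ` e \<inter> S = {}"
      using hS(1) ev by auto
    ultimately show ?thesis
      by (simp add: del_verts_def)
  qed
  moreover have "inj_on h (\<Union>Q)"
    using inj Q(2) inj_on_subset by blast
  ultimately show ?thesis
    unfolding embeds_def by blast
qed

text \<open>At most \<open>t\<close> vertices are sent to apexes; these are deleted, and the rest is
  mapped into \<open>Q\<close>.\<close>

lemma embeds_cone_del_verts:
  assumes Q: "edge_set Q" "\<Union>Q \<subseteq> {..<v}" and emb: "embeds E (cone v t Q)"
  obtains S where "finite S" "card S \<le> t" "embeds (del_verts E S) Q"
proof -
  obtain f where f: "inj_on f (\<Union>E)" "\<And>e. e \<in> E \<Longrightarrow> f ` e \<in> cone v t Q"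
    using emb unfolding embeds_def by blast
  define S where "S = {x \<in> \<Union>E. v \<le> f x}"
  have im: "f ` S \<subseteq> {v..<v + t}"
    using f(2) edge_set_cone(2)[OF Q, of t] by (fastforce simp: S_def)
  have inj: "inj_on f S"
    using f(1) by (auto simp: S_def intro: inj_on_subset)
  have "finite S"
    using inj_on_finite[OF inj im] by simp
  moreover have "card S \<le> t"
    using card_inj_on_le[OF inj im] by simp
  moreover have "embeds (del_verts E S) Q"
    unfolding embeds_def
  proof (intro exI conjI ballI)
    show "inj_on f (\<Union>(del_verts E S))"
      using f(1) by (rule inj_on_subset) (auto simp: del_verts_def)
    fix e assume "e \<in> del_verts E S"
    then have e: "e \<in> E" "e \<inter> S = {}"
      by (auto simp: del_verts_def)
    then have "f ` e \<subseteq> {..<v}"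
      by (force simp: S_def not_le)
    then show "f ` e \<in> Q"
      using f(2)[OF e(1)] by (auto simp: cone_def apex_edges_def)
  qed
  ultimately show thesis
    using that by blast
qed

text \<open>Pulling the deleted set back along the embedding shows that being \<open>t\<close>
  deletions away from a subgraph-closed class is again closed under subgraphs.\<close>

lemma embeds_del_verts:
  assumes "embeds E' E" "finite S"
  obtains S' where "finite S'" "card S' \<le> card S" "embeds (del_verts E' S') (del_verts E S)"
proof -
  obtain f where f: "inj_on f (\<Union>E')" "\<And>e. e \<in> E' \<Longrightarrow> f ` e \<in> E"
    using assms unfolding embeds_def by blast
  define S' where "S' = {x \<in> \<Union>E'. f x \<in> S}"
  have im: "f ` S' \<subseteq> S"
    by (auto simp: S'_def)
  have inj: "inj_on f S'"
    using f(1) by (rule inj_on_subset) (auto simp: S'_def)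
  have "embeds (del_verts E' S') (del_verts E S)"
    unfolding embeds_def
  proof (intro exI conjI ballI)
    show "inj_on f (\<Union>(del_verts E' S'))"
      using f(1) by (rule inj_on_subset) (auto simp: del_verts_def)
    fix e assume "e \<in> del_verts E' S'"
    then show "f ` e \<in> del_verts E S"
      using f(2)[of e] by (auto simp: del_verts_def S'_def)
  qed
  then show thesis
    using that inj_on_finite[OF inj im assms(2)] card_inj_on_le[OF inj im assms(2)] by blast
qed

lemma del_verts_mono: "E \<subseteq> E' \<Longrightarrow> S' \<subseteq> S \<Longrightarrow> del_verts E S \<subseteq> del_verts E' S'"
  by (auto simp: del_verts_def)

section \<open>The family belonging to a sequence of extremal graphs\<close>

text \<open>The intended extremal graph on \<open>n\<close> vertices is \<open>Q n\<close> joined to \<open>t\<close> apexes, plus isolated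
  vertices. The family is the complement of a class closed under subgraphs: \<open>admissible n E\<close> says that a graph
  on \<open>n\<close> vertices with edge set \<open>E\<close> is either \<open>t\<close> vertices away from avoiding all \<open>Q k\<close> with
  \<open>k \<le> n\<close>, in which case it may be given \<open>t\<close> vertices of full degree and so too many edges to matter,
  or a subgraph of an extremal graph on at least \<open>n\<close> vertices.\<close>

locale extremal_sequence =
  fixes v s :: "nat \<Rightarrow> nat" and Q :: "nat \<Rightarrow> nat set set" and t N0 :: nat
  assumes t_pos: "0 < t"
    and Q: "N0 \<le> n \<Longrightarrow> edge_set (Q n)" "N0 \<le> n \<Longrightarrow> \<Union>(Q n) \<subseteq> {..<v n}"
    and size: "N0 \<le> n \<Longrightarrow> v n + t < n"
    and card_G: "N0 \<le> n \<Longrightarrow> card (cone (v n) t (Q n)) = s n"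
    and s_le: "N0 \<le> n \<Longrightarrow> s n \<le> t * (n - t)"
    and antichain: "N0 \<le> n \<Longrightarrow> n \<le> k \<Longrightarrow> k \<le> n' \<Longrightarrow> embeds (Q n) (Q n') \<Longrightarrow> Q k = Q n' \<and> v k = v n'"
begin

abbreviation G :: "nat \<Rightarrow> nat set set" where
  "G n \<equiv> cone (v n) t (Q n)"

definition admissible :: "nat \<Rightarrow> nat set set \<Rightarrow> bool" where
  "admissible n E \<longleftrightarrow>
     (\<exists>S. finite S \<and> card S \<le> t \<and> (\<forall>k. N0 \<le> k \<and> k \<le> n \<longrightarrow> \<not> embeds (Q k) (del_verts E S))) \<or>
     (\<exists>k. N0 \<le> k \<and> n \<le> k \<and> embeds E (G k))"

definition family :: "nat graph set" where
  "family = {F. simple_graph F \<and> \<not> admissible (card (verts F)) (edges F)}"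

text \<open>A smaller order leaves fewer \<open>Q k\<close> to avoid in the first alternative and
  more \<open>G k\<close> to choose from in the second. This closure is what makes the complement
  \<open>family\<close> forbid exactly the inadmissible graphs.\<close>

lemma admissible_mono:
  assumes "admissible n E" "n' \<le> n" "embeds E' E"
  shows "admissible n' E'"
  using assms(1) unfolding admissible_def
proof (elim disjE exE conjE)
  fix S assume S: "finite S" "card S \<le> t" "\<forall>k. N0 \<le> k \<and> k \<le> n \<longrightarrow> \<not> embeds (Q k) (del_verts E S)"
  obtain S' where "finite S'" "card S' \<le> card S" "embeds (del_verts E' S') (del_verts E S)"
    using embeds_del_verts[OF assms(3) S(1)] .
  then have "finite S' \<and> card S' \<le> t \<and> (\<forall>k. N0 \<le> k \<and> k \<le> n' \<longrightarrow> \<not> embeds (Q k) (del_verts E' S'))"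
    using S assms(2) embeds_trans by (meson le_trans)
  then show "(\<exists>S. finite S \<and> card S \<le> t \<and> (\<forall>k. N0 \<le> k \<and> k \<le> n' \<longrightarrow> \<not> embeds (Q k) (del_verts E' S))) \<or>
      (\<exists>k. N0 \<le> k \<and> n' \<le> k \<and> embeds E' (G k))"
    by blast
next
  fix k assume "N0 \<le> k" "n \<le> k" "embeds E (G k)"
  then have "N0 \<le> k \<and> n' \<le> k \<and> embeds E' (G k)"
    using assms(2,3) embeds_trans by (meson le_trans)
  then show "(\<exists>S. finite S \<and> card S \<le> t \<and> (\<forall>k. N0 \<le> k \<and> k \<le> n' \<longrightarrow> \<not> embeds (Q k) (del_verts E' S))) \<or>
      (\<exists>k. N0 \<le> k \<and> n' \<le> k \<and> embeds E' (G k))"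
    by blast
qed

lemma admissible_empty: "admissible n {}"
proof -
  have "embeds ({} :: nat set set) (G (max n N0))"
    by (intro embeds_refl) simp
  then show ?thesis
    unfolding admissible_def by (intro disjI2 exI[of _ "max n N0"]) simp
qed

lemma forb_iff:
  assumes "simple_graph (V, E)"
  shows "forb family (card V) E \<longleftrightarrow> \<not> admissible (card V) E"
proof
  assume "forb family (card V) E"
  then show "\<not> admissible (card V) E"
    using admissible_mono unfolding forb_def family_def by blast
next
  assume "\<not> admissible (card V) E"
  then have "(V, E) \<in> family"
    using assms by (simp add: family_def)
  then show "forb family (card V) E"
    unfolding forb_def by (intro bexI[of _ "(V, E)"]) (auto intro: embeds_refl)
qed

text \<open>The first alternative fails since \<open>Q n\<close> survives every deletion of
  \<open>t\<close> vertices from its cone. In the second one, deleting the vertices of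
  \<open>G n\<close> sent to apexes shows that \<open>Q n\<close> embeds into \<open>Q k\<close>;
  then \<open>G k = G n\<close> has too few edges to receive \<open>E\<close>.\<close>

lemma not_admissible:
  assumes n: "N0 \<le> n" and E: "G n \<subseteq> E" "s n < card E"
  shows "\<not> admissible n E"
  unfolding admissible_def
proof (intro notI, elim disjE exE conjE)
  fix S assume S: "finite S" "card S \<le> t" "\<forall>k. N0 \<le> k \<and> k \<le> n \<longrightarrow> \<not> embeds (Q k) (del_verts E S)"
  have "embeds (Q n) (del_verts E S)"
    using embeds_mono[OF embeds_del_verts_cone[OF Q[OF n] S(1,2)] order_refl del_verts_mono[OF E(1) order_refl]] .
  then show False
    using S n by blast
next
  fix k assume k: "N0 \<le> k" "n \<le> k" and emb: "embeds E (G k)"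
  have "embeds (G n) (G k)"
    using embeds_mono[OF emb E(1) order_refl] .
  then obtain S where S: "finite S" "card S \<le> t" "embeds (del_verts (G n) S) (Q k)"
    using embeds_cone_del_verts[OF Q[OF k(1)]] by blast
  then have "embeds (Q n) (Q k)"
    using embeds_trans embeds_del_verts_cone[OF Q[OF n] S(1,2)] by blast
  then have "G n = G k"
    using antichain[of n n k] n k by simp
  moreover have "finite (G k)"
    using edge_set_cone(1)[OF Q[OF k(1)]] by (simp add: edge_set_def)
  ultimately have "card E \<le> card (G n)"
    using embeds_card_le[OF emb] by metis
  then show False
    using E(2) card_G[OF n] by simp
qed

lemma simple_graph_G: "N0 \<le> n \<Longrightarrow> simple_graph ({..<n}, G n)"
  using edge_set_cone[OF Q[of n], of t] size[of n] by (force simp: simple_graph_iff)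

lemma not_admissible_insert:
  assumes "N0 \<le> n" "{x, y} \<notin> G n"
  shows "\<not> admissible n (insert {x, y} (G n))"
proof (rule not_admissible)
  have "finite (G n)"
    using edge_set_cone(1)[OF Q[OF assms(1)]] by (simp add: edge_set_def)
  then show "s n < card (insert {x, y} (G n))"
    using assms card_G by simp
qed (use assms in auto)

lemma graph_family_family: "graph_family family"
  unfolding graph_family_def
proof (intro conjI ballI)
  have n: "N0 \<le> N0" by simp
  \<comment> \<open>By \<open>size\<close>, the vertex \<open>N0 - 1\<close> is isolated at order
    \<open>N0\<close>, so this pair is a non-edge whose addition yields a member of the
    family.\<close>
  have "{0, N0 - 1} \<notin> G N0"
    using edge_set_cone(2)[OF Q[OF n], of t] size[OF n] by auto
  moreover have "0 \<noteq> N0 - 1" "0 < N0"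
    using size[OF n] t_pos by auto
  ultimately have "({..<N0}, insert {0, N0 - 1} (G N0)) \<in> family"
    using not_admissible_insert[OF n] simple_graph_G[OF n]
    by (auto simp: family_def simple_graph_iff edge_set_insert)
  then show "family \<noteq> {}" by blast
  fix F assume F: "F \<in> family"
  then show "simple_graph F"
    by (simp add: family_def)
  moreover have "edges F \<noteq> {}"
    using F admissible_empty[of "card (verts F)"] by (auto simp: family_def)
  ultimately show "1 \<le> card (edges F)"
    by (simp add: simple_graph_iff edge_set_def Suc_le_eq card_gt_0_iff)
qed

lemma saturated_family_iff:
  "saturated family (V, E) \<longleftrightarrow> simple_graph (V, E) \<and> admissible (card V) E \<and>
    (\<forall>x\<in>V. \<forall>y\<in>V. x \<noteq> y \<and> {x, y} \<notin> E \<longrightarrow> \<not> admissible (card V) (insert {x, y} E))"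
proof -
  have "simple_graph (V, insert {x, y} E)" if "simple_graph (V, E)" "x \<in> V" "y \<in> V" "x \<noteq> y" for x y
    using that by (simp add: simple_graph_iff edge_set_insert)
  then show ?thesis
    unfolding saturated_iff[OF graph_family_family] by (auto simp: forb_iff)
qed

lemma saturated_G:
  assumes n: "N0 \<le> n"
  shows "saturated family ({..<n}, G n)"
  unfolding saturated_family_iff
proof (intro conjI ballI impI)
  show "admissible (card {..<n}) (G n)"
    unfolding admissible_def using n by (intro disjI2 exI[of _ n]) (auto intro: embeds_refl)
qed (use n simple_graph_G not_admissible_insert in auto)

text \<open>Saturated graphs of the first kind have \<open>t\<close> vertices of full degree. One of
  the second kind, inside some \<open>G k\<close>, is either also of the first kind, or
  \<open>G k = G n\<close> and saturation leaves out no edge of \<open>G n\<close>.\<close>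

lemma card_saturated_ge:
  fixes V :: "nat set"
  assumes n: "N0 \<le> n" and sat: "saturated family (V, E)" and V: "card V = n"
  shows "s n \<le> card E"
proof -
  have E: "finite V" "edge_set E" "\<Union>E \<subseteq> V" and adm: "admissible n E"
    and max: "\<And>x y. x \<in> V \<Longrightarrow> y \<in> V \<Longrightarrow> x \<noteq> y \<Longrightarrow> admissible n (insert {x, y} E) \<Longrightarrow> {x, y} \<in> E"
    using sat V unfolding saturated_family_iff by (auto simp: simple_graph_iff)
  have finE: "finite E"
    using E(2) by (simp add: edge_set_def)
  have avoid: "s n \<le> card E"
    if S: "finite S" "card S \<le> t" "\<And>k. N0 \<le> k \<Longrightarrow> k \<le> n \<Longrightarrow> \<not> embeds (Q k) (del_verts E S)" for S
  proof -
    \<comment> \<open>To get exactly \<open>t\<close> vertices of full degree, the deleted set is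
      cut down to \<open>V\<close> and then enlarged to size \<open>t\<close>, which only removes
      more edges from the remainder.\<close>
    have "card (S \<inter> V) \<le> t"
      using S(1,2) card_mono[of S "S \<inter> V"] by simp
    then obtain S1 where S1: "S \<inter> V \<subseteq> S1" "S1 \<subseteq> V" "card S1 = t"
      using exists_subset_between[of "S \<inter> V" t V] E(1) V size[OF n] by auto
    have finS1: "finite S1"
      using S1(2) E(1) finite_subset by blast
    have "del_verts E S1 \<subseteq> del_verts E S"
      using S1(1) E(3) by (auto simp: del_verts_def)
    then have S1': "\<not> embeds (Q k) (del_verts E S1)" if "N0 \<le> k" "k \<le> n" for k
      using S(3)[OF that] embeds_mono by blast
    \<comment> \<open>An edge at \<open>S1\<close> vanishes with \<open>S1\<close>, so adding it
      preserves admissibility; by saturation it is already present.\<close>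
    have full: "{x, y} \<in> E" if xy: "x \<in> S1" "y \<in> V" "x \<noteq> y" for x y
    proof (rule max)
      have "del_verts (insert {x, y} E) S1 = del_verts E S1"
        using xy by (auto simp: del_verts_def)
      then show "admissible n (insert {x, y} E)"
        unfolding admissible_def using S1' S1(3) finS1 by (intro disjI1 exI[of _ S1]) auto
    qed (use xy S1 in auto)
    let ?p = "\<lambda>(x, y). {x, y}"
    have "s n \<le> t * (n - t)"
      using s_le n by simp
    also have "\<dots> = card (S1 \<times> (V - S1))"
      using S1 V finS1 by (simp add: card_cartesian_product card_Diff_subset)
    also have "\<dots> \<le> card E"
    proof (rule card_inj_on_le)
      show "inj_on ?p (S1 \<times> (V - S1))"
        by (auto simp: inj_on_def doubleton_eq_iff)
      show "?p ` (S1 \<times> (V - S1)) \<subseteq> E"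
        using full by auto
    qed (rule finE)
    finally show ?thesis .
  qed
  consider S where "finite S" "card S \<le> t" "\<And>k. N0 \<le> k \<Longrightarrow> k \<le> n \<Longrightarrow> \<not> embeds (Q k) (del_verts E S)"
    | k where "N0 \<le> k" "n \<le> k" "embeds E (G k)"
    using adm unfolding admissible_def by blast
  then show ?thesis
  proof cases
    case 1
    then show ?thesis by (rule avoid)
  next
    case (2 k)
    show ?thesis
    \<comment> \<open>The form of \<open>antichain\<close> with an intermediate index is made for
      this case: applied to \<open>j \<le> n \<le> k\<close> it identifies \<open>G n\<close> with
      \<open>G k\<close>. If there is no such \<open>j\<close>, then deleting the preimages of the
      apexes leaves a graph without any \<open>Q j\<close>, \<open>j \<le> n\<close>, and
      \<open>avoid\<close> applies.\<close>
    proof (cases "\<exists>j. N0 \<le> j \<and> j \<le> n \<and> embeds (Q j) (Q k)")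
      case True
      then have "G n = G k"
        using antichain 2(2) by metis
      then obtain f where f: "inj_on f (\<Union>E)" "\<And>e. e \<in> E \<Longrightarrow> f ` e \<in> G n"
        using 2(3) unfolding embeds_def by auto
      have Gn: "edge_set (G n)" "\<Union>(G n) \<subseteq> {..<n}"
        using simple_graph_G[OF n] by (auto simp: simple_graph_iff)
      have "f ` \<Union>E \<subseteq> {..<n}"
        using f(2) Gn(2) by blast
      then obtain g where g: "inj_on g V" "g ` V \<subseteq> {..<n}" "\<And>x. x \<in> \<Union>E \<Longrightarrow> g x = f x"
        using extend_inj_on[of V "{..<n}" "\<Union>E" f] E f(1) V
        by (metis card_lessThan finite_lessThan order_refl)
      have surj: "g ` V = {..<n}"
        using g V card_image[OF g(1)] by (intro card_subset_eq) auto
      have ge: "g ` e \<in> G n" if e: "e \<in> E" for e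
      proof -
        have "g ` e = f ` e"
          using g(3) e by (intro image_cong) auto
        then show ?thesis using f(2) e by simp
      qed
      show ?thesis
      proof (rule ccontr)
        assume "\<not> ?thesis"
        moreover have "card ((`) g ` E) \<le> card E"
          using finE by (rule card_image_le)
        ultimately have "\<not> G n \<subseteq> (`) g ` E"
          using card_G[OF n] card_mono[of "(`) g ` E" "G n"] finE by auto
        then obtain e where e: "e \<in> G n" "e \<notin> (`) g ` E" by blast
        then obtain a b where ab: "e = {a, b}" "a \<noteq> b" "a < n" "b < n"
        proof -
          have "card e = 2" "e \<subseteq> {..<n}"
            using Gn e(1) by (auto simp: edge_set_def)
          then show thesis
            using that by (auto simp: card_2_iff)
        qed
        then obtain x y where xy: "x \<in> V" "y \<in> V" "a = g x" "b = g y"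
          using surj by (metis imageE lessThan_iff)
        have "{x, y} \<notin> E"
        proof
          assume "{x, y} \<in> E"
          then have "g ` {x, y} \<in> (`) g ` E" by (rule imageI)
          then show False using e(2) ab xy by simp
        qed
        moreover have "embeds (insert {x, y} E) (G n)"
          unfolding embeds_def
        proof (intro exI conjI ballI)
          show "inj_on g (\<Union>(insert {x, y} E))"
            using g(1) by (rule inj_on_subset) (use E(3) xy in auto)
          show "g ` d \<in> G n" if "d \<in> insert {x, y} E" for d
            using that ge e(1) ab xy by auto
        qed
        then have "admissible n (insert {x, y} E)"
          unfolding admissible_def using n by blast
        ultimately show False
          using max xy ab by blast
      qed
    next
      case False
      obtain S where S: "finite S" "card S \<le> t" "embeds (del_verts E S) (Q k)"
        using embeds_cone_del_verts[OF Q[OF 2(1)] 2(3)] .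
      show ?thesis
      proof (rule avoid[OF S(1,2)])
        fix j assume "N0 \<le> j" "j \<le> n"
        then show "\<not> embeds (Q j) (del_verts E S)"
          using False S(3) embeds_trans by blast
      qed
    qed
  qed
qed

lemma sat_family:
  assumes n: "N0 \<le> n"
  shows "sat n family = s n"
proof (rule antisym)
  show "sat n family \<le> s n"
    using sat_le[OF saturated_G[OF n]] card_G[OF n] by simp
  obtain H :: "nat graph" where "saturated family H" "card (verts H) = n" "card (edges H) = sat n family"
    using sat_attained[OF graph_family_family] .
  then show "s n \<le> sat n family"
    using card_saturated_ge[OF n, of "verts H" "edges H"] by simp
qed

end

section \<open>An antichain of graphs\<close>

definition cyc :: "nat \<Rightarrow> nat \<Rightarrow> nat set set" where
  "cyc p n = (\<lambda>i. {p + i, p + Suc i mod n}) ` {..<n}"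

definition bip :: "nat \<Rightarrow> nat set set" where
  "bip w = (\<lambda>(x, y). {x, w + y}) ` ({..<w} \<times> {..<w})"

lemma Union_cyc: "\<Union>(cyc p n) \<subseteq> {p..<p + n}"
  by (fastforce simp: cyc_def)

lemma edge_set_cyc:
  assumes "2 \<le> n"
  shows "edge_set (cyc p n)"
proof -
  have "i \<noteq> Suc i mod n" if "i < n" for i
    using assms that by (cases "Suc i = n") auto
  then show ?thesis
    unfolding edge_set_def cyc_def by auto
qed

lemma card_cyc_le: "card (cyc p n) \<le> n"
  unfolding cyc_def using card_image_le[of "{..<n}"] by fastforce

lemma Union_bip: "\<Union>(bip w) \<subseteq> {..<2 * w}"
  by (auto simp: bip_def)

lemma edge_set_bip: "edge_set (bip w)"
  by (auto simp: bip_def edge_set_def)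

lemma card_bip: "card (bip w) = w * w"
proof -
  have "inj_on (\<lambda>(x, y). {x, w + y}) ({..<w} \<times> {..<w})"
    by (auto simp: inj_on_def doubleton_eq_iff)
  then show ?thesis
    unfolding bip_def by (simp add: card_image)
qed

lemma bip_alternates: "{x, y} \<in> bip w \<Longrightarrow> x < w \<longleftrightarrow> \<not> y < w"
  by (auto simp: bip_def doubleton_eq_iff)

lemma cyc_edgeD:
  assumes "{x, y} \<in> cyc p n"
  shows "x \<in> {p..<p + n}" "y - p = Suc (x - p) mod n \<or> x - p = Suc (y - p) mod n"
  using assms by (auto simp: cyc_def doubleton_eq_iff)

lemma Suc_mod_inj:
  assumes "Suc i mod n = Suc j mod n" "i < n" "j < n"
  shows "i = j"
  using assms by (cases "Suc i = n"; cases "Suc j = n") auto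

text \<open>The vertices visited by a walk in a cycle that never turns back are closed under taking the
  cyclic successor.\<close>

lemma walk_covers_cycle:
  assumes walk: "\<And>i. {x i, x (Suc i)} \<in> cyc p n"
    and no_turn: "\<And>i. x i \<noteq> x (Suc (Suc i))" and period: "\<And>i. x (i + a) = x i" "0 < a"
  shows "n \<le> a"
proof -
  define y where "y i = x i - p" for i
  have x: "x i = p + y i" "y i < n" for i
    using cyc_edgeD(1)[OF walk[of i]] by (auto simp: y_def)
  have step: "y (Suc i) = Suc (y i) mod n \<or> y i = Suc (y (Suc i)) mod n" for i
    using cyc_edgeD(2)[OF walk[of i]] by (simp add: y_def)
  have per: "y (i + a) = y i" for i
    using period(1) by (simp add: y_def)
  have closed: "\<exists>j. y j = Suc (y i) mod n" for i
  proof -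
    \<comment> \<open>Shifting by the period provides a time before \<open>i\<close>. The walk is at
      \<open>y i\<close> at time \<open>k + 1\<close>, and its positions at times \<open>k\<close>
      and \<open>k + 2\<close> are distinct neighbours of it, so one of them is the cyclic
      successor.\<close>
    obtain k where k: "i + a = Suc k"
      using period(2) by (metis add_is_0 gr0_implies_Suc neq0_conv)
    have yk: "y (Suc k) = y i"
      using per[of i] k by simp
    show ?thesis
    proof (cases "y (Suc (Suc k)) = Suc (y i) mod n")
      case False
      then have "y i = Suc (y (Suc (Suc k))) mod n"
        using step[of "Suc k"] yk by simp
      moreover have "y k \<noteq> y (Suc (Suc k))"
        using no_turn[of k] x by metis
      ultimately have "y k = Suc (y i) mod n"
        using step[of k] Suc_mod_inj[of "y k" n "y (Suc (Suc k))"] x(2) yk by metis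
      then show ?thesis by blast
    qed blast
  qed
  have reach: "\<exists>j. y j = (y 0 + k) mod n" for k
  proof (induction k)
    case 0
    then show ?case using x(2)[of 0] by (intro exI[of _ 0]) simp
  next
    case (Suc k)
    then obtain i where "y i = (y 0 + k) mod n" by blast
    with closed[of i] show ?case
      by (simp add: mod_Suc_eq)
  qed
  have "{..<n} \<subseteq> y ` {..<a}"
  proof
    fix z assume z: "z \<in> {..<n}"
    have "(y 0 + (z + n - y 0)) mod n = z"
      using z x(2)[of 0] by simp
    then obtain j where j: "y j = z"
      using reach by metis
    have "y (j mod a + k * a) = y (j mod a)" for k
      by (induction k) (use per in \<open>auto simp: algebra_simps\<close>, metis add.assoc add.commute)
    then have "y (j mod a) = z"
      using j by (metis mod_div_mult_eq)
    then show "z \<in> y ` {..<a}"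
      using period(2) by (intro image_eqI[of _ _ "j mod a"]) auto
  qed
  then show ?thesis
    using card_mono[of "y ` {..<a}" "{..<n}"] card_image_le[of "{..<a}" y] by simp
qed

text \<open>The image is a closed walk of odd length. The three parts have disjoint vertex sets, so
  it stays in one of them, and not in the bipartite one, where the sides alternate. In a cycle it
  never turns back, as \<open>a \<ge> 3\<close>, so it visits the whole cycle; injectivity gives the
  other inequality.\<close>

lemma embeds_odd_cycle:
  assumes a: "odd a" "3 \<le> a" and emb: "embeds (cyc p a) (Y \<union> cyc p1 a1 \<union> cyc p2 a2)"
    and Y: "Y \<subseteq> bip w" and p: "2 * w \<le> p1" "p1 + a1 \<le> p2"
  shows "a = a1 \<or> a = a2"
proof -
  let ?E = "Y \<union> cyc p1 a1 \<union> cyc p2 a2"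
  obtain f where f: "inj_on f (\<Union>(cyc p a))" "\<And>e. e \<in> cyc p a \<Longrightarrow> f ` e \<in> ?E"
    using emb unfolding embeds_def by blast
  define x where "x i = f (p + i mod a)" for i
  have in_cyc: "{p + i mod a, p + Suc i mod a} \<in> cyc p a" for i
    unfolding cyc_def using a by (intro image_eqI[of _ _ "i mod a"]) (auto simp: mod_Suc_eq)
  have edge: "{x i, x (Suc i)} \<in> ?E" for i
    using f(2)[OF in_cyc[of i]] by (simp add: x_def)
  have x_eq: "x i = x j \<longleftrightarrow> i mod a = j mod a" for i j
  proof -
    have "p + i mod a \<in> \<Union>(cyc p a)" "p + j mod a \<in> \<Union>(cyc p a)"
      using in_cyc by blast+
    then show ?thesis
      unfolding x_def using inj_on_eq_iff[OF f(1)] by simp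
  qed
  have period: "x (i + a) = x i" for i
    by (simp add: x_eq)
  have no_turn: "x i \<noteq> x (Suc (Suc i))" for i
  proof
    assume "x i = x (Suc (Suc i))"
    then have "i mod a = (i + 2) mod a"
      by (simp add: x_eq)
    then have "a dvd (i + 2) - i"
      by (metis mod_eq_dvd_iff_nat le_add1)
    then show False
      using a by (simp add: nat_dvd_not_less)
  qed
  have inj: "inj_on x {..<a}"
    by (auto simp: inj_on_def x_eq)
  have in_Y: "\<Union>Y \<subseteq> {..<2 * w}"
    using Y Union_bip by blast
  have cycle: "a = a'" if walk: "\<And>i. {x i, x (Suc i)} \<in> cyc p' a'" for p' a'
  proof (rule antisym)
    have "x ` {..<a} \<subseteq> {p'..<p' + a'}"
      using cyc_edgeD(1)[OF walk] by auto
    then show "a \<le> a'"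
      using card_inj_on_le[OF inj, of "{p'..<p' + a'}"] by simp
    show "a' \<le> a"
      using walk_covers_cycle[OF walk no_turn period] a by simp
  qed
  have Y_edge: "x i < 2 * w \<and> x (Suc i) < 2 * w" if "{x i, x (Suc i)} \<in> Y" for i
    using in_Y that by auto
  have c1_edge: "x i \<in> {p1..<p1 + a1} \<and> x (Suc i) \<in> {p1..<p1 + a1}" if "{x i, x (Suc i)} \<in> cyc p1 a1" for i
    using Union_cyc[of p1 a1] that by auto
  have c2_edge: "x i \<in> {p2..<p2 + a2} \<and> x (Suc i) \<in> {p2..<p2 + a2}" if "{x i, x (Suc i)} \<in> cyc p2 a2" for i
    using Union_cyc[of p2 a2] that by auto
  consider "{x 0, x (Suc 0)} \<in> Y" | "{x 0, x (Suc 0)} \<in> cyc p1 a1" | "{x 0, x (Suc 0)} \<in> cyc p2 a2"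
    using edge[of 0] by blast
  then show ?thesis
  proof cases
    case 1
    have walk: "{x i, x (Suc i)} \<in> Y" for i
    proof (induction i)
      case (Suc i)
      then have "x (Suc i) < 2 * w"
        using Y_edge by blast
      then show ?case
        using edge[of "Suc i"] c1_edge[of "Suc i"] c2_edge[of "Suc i"] p by auto
    qed (use 1 in simp)
    have "x i < w \<longleftrightarrow> (x 0 < w \<longleftrightarrow> even i)" for i
    proof (induction i)
      case (Suc i)
      have "{x i, x (Suc i)} \<in> bip w"
        using walk[of i] Y by blast
      then show ?case
        using bip_alternates Suc by fastforce
    qed simp
    from this[of a] show ?thesis
      using a(1) period[of 0] by simp
  next
    case 2
    have "{x i, x (Suc i)} \<in> cyc p1 a1" for i
    proof (induction i)
      case (Suc i)
      then have "x (Suc i) \<in> {p1..<p1 + a1}"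
        using c1_edge by blast
      then show ?case
        using edge[of "Suc i"] Y_edge[of "Suc i"] c2_edge[of "Suc i"] p by auto
    qed (use 2 in simp)
    then show ?thesis
      using cycle by blast
  next
    case 3
    have "{x i, x (Suc i)} \<in> cyc p2 a2" for i
    proof (induction i)
      case (Suc i)
      then have "x (Suc i) \<in> {p2..<p2 + a2}"
        using c2_edge by blast
      then show ?case
        using edge[of "Suc i"] Y_edge[of "Suc i"] c1_edge[of "Suc i"] p by auto
    qed (use 3 in simp)
    then show ?thesis
      using cycle by blast
  qed
qed

section \<open>Antichains by counting\<close>

lemma embeds_sym:
  assumes "embeds A B" "finite B" "card A = card B"
  shows "embeds B A"
proof -
  obtain f where f: "inj_on f (\<Union>A)" "\<And>e. e \<in> A \<Longrightarrow> f ` e \<in> B"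
    using assms(1) unfolding embeds_def by blast
  have "(`) f ` A = B"
    using f assms(2,3) card_image[OF inj_on_image_of_edges[OF f(1)]]
    by (intro card_subset_eq) auto
  then show ?thesis
    using embeds_image(2)[OF f(1) order_refl] by simp
qed

text \<open>Equality of the edge numbers makes \<open>B\<close> the full image of \<open>A\<close>,
  so \<open>B\<close> is determined by the embedding, and there are \<open>v ^ v\<close> maps from
  \<open>{..<v}\<close> to itself.\<close>

lemma card_embeds_le:
  assumes v: "0 < v" and A: "\<Union>A \<subseteq> {..<v}"
    and \<Q>: "\<And>B. B \<in> \<Q> \<Longrightarrow> finite B \<and> \<Union>B \<subseteq> {..<v} \<and> card B = card A"
  shows "card {B \<in> \<Q>. embeds A B} \<le> v ^ v"
proof -
  let ?P = "{..<v} \<rightarrow>\<^sub>E {..<v}"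
  have "{B \<in> \<Q>. embeds A B} \<subseteq> (\<lambda>f. (`) f ` A) ` ?P"
  proof
    fix B assume "B \<in> {B \<in> \<Q>. embeds A B}"
    then obtain f where B: "B \<in> \<Q>" and f: "inj_on f (\<Union>A)" "\<And>e. e \<in> A \<Longrightarrow> f ` e \<in> B"
      unfolding embeds_def by blast
    have im: "(`) f ` A = B"
      using f \<Q>[OF B] card_image[OF inj_on_image_of_edges[OF f(1)]]
      by (intro card_subset_eq) auto
    \<comment> \<open>The embedding is filled up to a map counted by \<open>?P\<close>; the default
      value 0 lies in \<open>{..<v}\<close> because \<open>0 < v\<close>.\<close>
    define g where "g = (\<lambda>x\<in>{..<v}. if x \<in> \<Union>A then f x else 0)"
    have "f ` \<Union>A \<subseteq> {..<v}"
      using f(2) \<Q>[OF B] by blast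
    then have "f x < v" if "x \<in> \<Union>A" for x
      using that by blast
    then have "g \<in> ?P"
      using v unfolding g_def by (intro restrict_PiE_iff[THEN iffD2]) auto
    moreover have "g ` e = f ` e" if "e \<in> A" for e
      using that A by (intro image_cong) (auto simp: g_def)
    then have "(`) g ` A = B"
      using im by (metis image_cong)
    ultimately show "B \<in> (\<lambda>f. (`) f ` A) ` ?P"
      by blast
  qed
  moreover have fin: "finite ?P"
    by (intro finite_PiE) auto
  ultimately have "card {B \<in> \<Q>. embeds A B} \<le> card ((\<lambda>f. (`) f ` A) ` ?P)"
    by (intro card_mono) auto
  also have "\<dots> \<le> card ?P"
    using fin by (rule card_image_le)
  also have "\<dots> = v ^ v"
    by (simp add: card_PiE)
  finally show ?thesis .
qed

text \<open>Greedy choice: each member chosen so far excludes at most \<open>v ^ v\<close> sets. It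
  is enough to keep old members from embedding into the new one, since embedding is symmetric
  between sets of equal finite size.\<close>

lemma ex_embedding_antichain:
  assumes v: "0 < v"
    and \<Q>: "\<And>A. A \<in> \<Q> \<Longrightarrow> finite A \<and> \<Union>A \<subseteq> {..<v} \<and> card A = q"
  shows "b * v ^ v \<le> card \<Q> \<Longrightarrow>
    \<exists>R\<subseteq>\<Q>. finite R \<and> card R = b \<and> (\<forall>A\<in>R. \<forall>B\<in>R. embeds A B \<longrightarrow> A = B)"
proof (induction b)
  case 0
  show ?case by (intro exI[of _ "{}"]) auto
next
  case (Suc b)
  then obtain R where R: "R \<subseteq> \<Q>" "finite R" "card R = b" "\<forall>A\<in>R. \<forall>B\<in>R. embeds A B \<longrightarrow> A = B"
    by auto
  have "card (\<Union>A\<in>R. {B \<in> \<Q>. embeds A B}) \<le> (\<Sum>A\<in>R. card {B \<in> \<Q>. embeds A B})"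
    by (rule card_UN_le) (rule R(2))
  also have "\<dots> \<le> (\<Sum>A\<in>R. v ^ v)"
  proof (intro sum_mono card_embeds_le v)
    fix A assume "A \<in> R"
    then have A: "finite A \<and> \<Union>A \<subseteq> {..<v} \<and> card A = q"
      using R(1) by (intro \<Q>) blast
    then show "\<Union>A \<subseteq> {..<v}"
      by blast
    show "finite B \<and> \<Union>B \<subseteq> {..<v} \<and> card B = card A" if "B \<in> \<Q>" for B
      using \<Q>[OF that] A by simp
  qed
  also have "\<dots> < Suc b * v ^ v"
    using R(3) v by simp
  also have "\<dots> \<le> card \<Q>"
    using Suc.prems .
  finally have lt: "card (\<Union>A\<in>R. {B \<in> \<Q>. embeds A B}) < card \<Q>" .
  have "\<not> \<Q> \<subseteq> (\<Union>A\<in>R. {B \<in> \<Q>. embeds A B})"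
  proof
    assume "\<Q> \<subseteq> (\<Union>A\<in>R. {B \<in> \<Q>. embeds A B})"
    then have "\<Q> = (\<Union>A\<in>R. {B \<in> \<Q>. embeds A B})" by blast
    with lt show False by simp
  qed
  then obtain B where B: "B \<in> \<Q>" "\<And>A. A \<in> R \<Longrightarrow> \<not> embeds A B"
    by blast
  have "\<not> embeds B A" if "A \<in> R" for A
    using embeds_sym[of B A] B that R(1) \<Q> by (metis subsetD)
  moreover have "B \<notin> R"
    using B(2) embeds_refl by blast
  ultimately show ?case
    using R B by (intro exI[of _ "insert B R"]) auto
qed

section \<open>The candidates with a prescribed number of edges\<close>

definition cyc_fst :: "nat \<Rightarrow> nat" where
  "cyc_fst m = 2 * fst (prod_decode m) + 3"

definition cyc_snd :: "nat \<Rightarrow> nat" where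
  "cyc_snd m = 2 * (fst (prod_decode m) + snd (prod_decode m)) + 5"

text \<open>The size of each side must satisfy two demands: its square divided by \<open>m\<close>
  should be \<open>m\<close> up to powers of \<open>ln m\<close>, and its product with
  \<open>ln m\<close> should be \<open>O(m)\<close> to keep \<open>v ^ v\<close> below
  \<open>exp (O(m))\<close>.\<close>

definition width :: "nat \<Rightarrow> nat" where
  "width m = nat \<lceil>real m / ln (real m)\<rceil>"

definition vnum :: "nat \<Rightarrow> nat" where
  "vnum m = 2 * width m + cyc_fst m + cyc_snd m"

definition gadget :: "nat \<Rightarrow> nat set set" where
  "gadget m = cyc (2 * width m) (cyc_fst m) \<union> cyc (2 * width m + cyc_fst m) (cyc_snd m)"

text \<open>This is what remains of \<open>m\<close> edges once apexes and cycles are paid for. The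
  subtraction is truncated; \<open>eventually_level_bounds\<close> shows that it is exact for large
  \<open>m\<close>.\<close>

definition bip_edges :: "nat \<Rightarrow> nat \<Rightarrow> nat" where
  "bip_edges t m = m - card (apex_edges (vnum m) t) - card (gadget m)"

definition level :: "nat \<Rightarrow> nat \<Rightarrow> nat set set set" where
  "level t m = (\<lambda>Y. Y \<union> gadget m) ` {Y. Y \<subseteq> bip (width m) \<and> card Y = bip_edges t m}"

text \<open>Using the sum of the coordinates and a larger constant in \<open>cyc_snd\<close>
  guarantees \<open>cyc_fst m < cyc_snd m\<close>. So the unordered pair of lengths determines the
  ordered one, and with it \<open>m\<close>.\<close>

lemma cyc_pair_inj:
  assumes "cyc_fst m \<in> {cyc_fst m', cyc_snd m'}" "cyc_snd m \<in> {cyc_fst m', cyc_snd m'}"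
  shows "m = m'"
proof -
  have "prod_decode m = prod_decode m'"
    using assms by (auto simp: cyc_fst_def cyc_snd_def prod_eq_iff)
  then show ?thesis
    using inj_prod_decode by (auto dest: injD)
qed

lemma gadget_facts:
  "edge_set (gadget m)" "\<Union>(gadget m) \<subseteq> {2 * width m..<vnum m}" "card (gadget m) \<le> cyc_fst m + cyc_snd m"
proof -
  have "2 \<le> cyc_fst m" "2 \<le> cyc_snd m"
    by (auto simp: cyc_fst_def cyc_snd_def)
  then show "edge_set (gadget m)"
    using edge_set_cyc unfolding gadget_def edge_set_def by blast
  show "\<Union>(gadget m) \<subseteq> {2 * width m..<vnum m}"
    unfolding gadget_def vnum_def using Union_cyc[of "2 * width m" "cyc_fst m"]
      Union_cyc[of "2 * width m + cyc_fst m" "cyc_snd m"] by fastforce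
  show "card (gadget m) \<le> cyc_fst m + cyc_snd m"
    unfolding gadget_def
    using card_Un_le[of "cyc (2 * width m) (cyc_fst m)" "cyc (2 * width m + cyc_fst m) (cyc_snd m)"]
      card_cyc_le[of "2 * width m" "cyc_fst m"] card_cyc_le[of "2 * width m + cyc_fst m" "cyc_snd m"]
    by linarith
qed

lemma bip_gadget_disjoint: "Y \<subseteq> bip (width m) \<Longrightarrow> Y \<inter> gadget m = {}"
proof -
  have "e \<notin> gadget m" if e: "e \<in> bip (width m)" for e
  proof
    assume "e \<in> gadget m"
    then have "e \<subseteq> {2 * width m..<vnum m}" "e \<subseteq> {..<2 * width m}"
      using gadget_facts(2) Union_bip e by blast+
    then have "e = {}" by fastforce
    then show False
      using e edge_set_bip[of "width m"] by (auto simp: edge_set_def)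
  qed
  then show "Y \<subseteq> bip (width m) \<Longrightarrow> Y \<inter> gadget m = {}"
    by blast
qed

lemma level_facts:
  assumes "A \<in> level t m"
  shows "edge_set A" "\<Union>A \<subseteq> {..<vnum m}" "card A = bip_edges t m + card (gadget m)"
proof -
  obtain Y where Y: "A = Y \<union> gadget m" "Y \<subseteq> bip (width m)" "card Y = bip_edges t m"
    using assms by (auto simp: level_def)
  have eY: "edge_set Y"
    using Y(2) edge_set_bip unfolding edge_set_def by (meson finite_subset subsetD)
  then show "edge_set A"
    using Y(1) gadget_facts(1) by (auto simp: edge_set_def)
  have "\<Union>Y \<subseteq> {..<2 * width m}"
    using Y(2) Union_bip by blast
  then show "\<Union>A \<subseteq> {..<vnum m}"
    using gadget_facts(2)[of m] unfolding Y(1) by (fastforce simp: vnum_def)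
  show "card A = bip_edges t m + card (gadget m)"
    using Y eY gadget_facts(1) bip_gadget_disjoint[OF Y(2)]
    by (simp add: card_Un_disjoint edge_set_def)
qed

lemma card_level: "card (level t m) = (width m * width m) choose bip_edges t m"
proof -
  have "inj_on (\<lambda>Y. Y \<union> gadget m) {Y. Y \<subseteq> bip (width m) \<and> card Y = bip_edges t m}"
    using bip_gadget_disjoint by (intro inj_onI) blast
  moreover have "finite (bip (width m))"
    using edge_set_bip by (simp add: edge_set_def)
  ultimately show ?thesis
    unfolding level_def by (simp add: card_image n_subsets card_bip)
qed

text \<open>Odd cycles only embed into the cycle components, whose lengths encode \<open>m\<close>.\<close>

lemma level_embeds:
  assumes A: "A \<in> level t m" and B: "B \<in> level t m'" and emb: "embeds A B"
  shows "m = m'"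
proof -
  obtain Y where Y: "B = Y \<union> gadget m'" "Y \<subseteq> bip (width m')"
    using B by (auto simp: level_def)
  have *: "a = cyc_fst m' \<or> a = cyc_snd m'" if "cyc p a \<subseteq> A" "odd a" "3 \<le> a" for p a
  proof -
    have "embeds (cyc p a) (Y \<union> cyc (2 * width m') (cyc_fst m') \<union> cyc (2 * width m' + cyc_fst m') (cyc_snd m'))"
      using embeds_mono[OF emb that(1) order_refl] unfolding Y(1) gadget_def by (simp add: Un_assoc)
    then show ?thesis
      by (intro embeds_odd_cycle[OF that(2,3) _ Y(2)]) auto
  qed
  have sub: "gadget m \<subseteq> A"
    using A by (auto simp: level_def)
  have "cyc_fst m = cyc_fst m' \<or> cyc_fst m = cyc_snd m'"
    by (rule *[of "2 * width m"]) (use sub in \<open>auto simp: gadget_def cyc_fst_def\<close>)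
  moreover have "cyc_snd m = cyc_fst m' \<or> cyc_snd m = cyc_snd m'"
    by (rule *[of "2 * width m + cyc_fst m"]) (use sub in \<open>auto simp: gadget_def cyc_snd_def\<close>)
  ultimately show ?thesis
    by (intro cyc_pair_inj) auto
qed

section \<open>Counting\<close>

definition upper_count :: "nat \<Rightarrow> nat" where
  "upper_count m = 8 * ((m + 1) * (6 * m + 1) ^ m)"

text \<open>Of the coefficient 3, two units come from the count \<open>(m / ln^2 m)^m\<close> of
  candidates, and the third absorbs all factors \<open>exp (O(m))\<close>. From \<open>m = 3\<close>
  on \<open>ln m \<ge> 1\<close>, so the subtracted term is nonnegative, as needed for
  \<open>lower_count m \<le> upper_count m\<close>.\<close>

definition lower_count :: "nat \<Rightarrow> nat" where
  "lower_count m =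
     (if m < 3 then 0 else nat \<lfloor>exp (real m * ln (real m) - 3 * real m * ln (ln (real m)))\<rfloor>)"

text \<open>\<open>k ^ k / k!\<close> is a single term of the exponential series at
  \<open>k\<close>, and \<open>exp 1 \<le> 3\<close>.\<close>

lemma power_self_le: "real k ^ k \<le> 3 ^ k * fact k"
proof -
  have "real k ^ k / fact k \<le> exp (real k)"
  proof -
    have "(\<Sum>n\<in>{k}. real k ^ n /\<^sub>R fact n) \<le> exp (real k)"
      unfolding exp_def using summable_exp_generic[of "real k"] by (intro sum_le_suminf) auto
    then show ?thesis
      by (simp add: field_simps)
  qed
  also have "\<dots> = exp 1 ^ k"
    by (simp add: exp_of_nat_mult[symmetric])
  also have "\<dots> \<le> 3 ^ k"
    using exp_le by (intro power_mono) auto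
  finally show ?thesis
    by (simp add: field_simps)
qed

text \<open>The 6 is \<open>2 * 3\<close>: there are at most \<open>2 * k ^ 2\<close> pairs,
  \<open>N choose k\<close> is at most \<open>N ^ k / k!\<close>, and \<open>k!\<close> is at least
  \<open>(k / 3) ^ k\<close>.\<close>

lemma choose_pairs_le: "(2 * k choose 2) choose k \<le> (6 * k) ^ k"
proof -
  have "2 * k choose 2 \<le> 2 * k ^ 2"
    by (simp add: choose_two power2_eq_square)
  have "((2 * k choose 2) choose k) * fact k \<le> (2 * k choose 2) ^ k"
    by (rule binomial_fact_pow)
  also have "\<dots> \<le> (2 * k ^ 2) ^ k"
    using \<open>2 * k choose 2 \<le> 2 * k ^ 2\<close> by (intro power_mono) simp_all
  also have "\<dots> = 2 ^ k * k ^ k * k ^ k"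
    by (simp add: power_mult_distrib power2_eq_square)
  also have "\<dots> \<le> 2 ^ k * k ^ k * (3 ^ k * fact k)"
  proof -
    have "real (k ^ k) \<le> real (3 ^ k * fact k)"
      using power_self_le[of k] by simp
    then show ?thesis
      using of_nat_le_iff by (intro mult_le_mono2) blast
  qed
  also have "\<dots> = (2 * 3 * k) ^ k * fact k"
    unfolding power_mult_distrib by (simp only: ac_simps)
  finally show ?thesis by simp
qed

lemma sum_choose_pairs_le: "8 * (\<Sum>k\<le>m. (2 * k choose 2) choose k) \<le> upper_count m"
proof -
  have "(\<Sum>k\<le>m. (2 * k choose 2) choose k) \<le> (\<Sum>k\<le>m. (6 * m + 1) ^ m)"
  proof (rule sum_mono)
    fix k assume k: "k \<in> {..m}"
    have "(2 * k choose 2) choose k \<le> (6 * k) ^ k"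
      by (rule choose_pairs_le)
    also have "\<dots> \<le> (6 * m + 1) ^ k"
      using k by (intro power_mono) auto
    \<comment> \<open>Monotonicity in the exponent needs a base of at least 1; the
      \<open>+ 1\<close> provides it also for \<open>m = 0\<close>.\<close>
    also have "\<dots> \<le> (6 * m + 1) ^ m"
      using k by (intro power_increasing) auto
    finally show "(2 * k choose 2) choose k \<le> (6 * m + 1) ^ m" .
  qed
  then show ?thesis
    by (simp add: upper_count_def)
qed

lemma ln_ge_1: "1 \<le> ln (real m)" if "3 \<le> m"
proof -
  have "exp 1 \<le> real m"
    using exp_le that by linarith
  then show ?thesis
    using that by (simp add: ln_ge_iff)
qed

lemma lower_count_le_exp:
  "3 \<le> m \<Longrightarrow> real (lower_count m) \<le> exp (real m * ln (real m) - 3 * real m * ln (ln (real m)))"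
  by (simp add: lower_count_def)

lemma lower_count_le_upper_count: "lower_count m \<le> upper_count m"
proof (cases "m < 3")
  case False
  then have m: "3 \<le> m" by simp
  have "real (lower_count m) \<le> exp (real m * ln (real m) - 3 * real m * ln (ln (real m)))"
    by (rule lower_count_le_exp) fact
  also have "\<dots> \<le> exp (real m * ln (real m))"
    using ln_ge_1[OF m] by simp
  also have "\<dots> = real (m ^ m)"
    using m by (simp add: exp_of_nat_mult)
  finally have "lower_count m \<le> m ^ m"
    using of_nat_le_iff by blast
  also have "\<dots> \<le> (6 * m + 1) ^ m"
    by (intro power_mono) auto
  also have "\<dots> \<le> upper_count m"
    by (simp add: upper_count_def)
  finally show ?thesis .
qed (simp add: lower_count_def)

section \<open>The number of candidates with \<open>m\<close> edges\<close>

lemma cyc_sum_le: "real (cyc_fst m + cyc_snd m) \<le> 4 * sqrt (2 * real m) + 8"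
proof -
  obtain x y where xy: "prod_decode m = (x, y)"
    by (cases "prod_decode m")
  then have m: "m = triangle (x + y) + x"
    using prod_decode_inverse[of m] by (simp add: prod_encode_def)
  \<comment> \<open>The pairing function runs along diagonals, so \<open>m\<close> is at least the
    triangular number of \<open>x + y\<close>; this is the source of the square root.\<close>
  have "2 * triangle (x + y) = (x + y) * Suc (x + y)"
    by (simp add: triangle_def)
  then have "(x + y) ^ 2 \<le> 2 * m"
    using m by (simp add: power2_eq_square)
  then have "real (x + y) ^ 2 \<le> 2 * real m"
    by (metis of_nat_le_iff of_nat_mult of_nat_numeral of_nat_power)
  then have "real (x + y) \<le> sqrt (2 * real m)"
    by (rule real_le_rsqrt)
  then show ?thesis
    using xy by (simp add: cyc_fst_def cyc_snd_def)
qed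

lemma eventually_ln_ge: "\<forall>\<^sub>F m in sequentially. Z \<le> ln (real m)" for Z :: real
proof -
  have "filterlim (\<lambda>m. ln (real m)) at_top sequentially" by real_asymp
  then show ?thesis by (simp add: filterlim_at_top)
qed

lemma eventually_level_bounds:
  fixes t c :: nat
  shows "\<forall>\<^sub>F m in sequentially. 0 < vnum m \<and> c * (vnum m + t) < m \<and>
    bip_edges t m + card (gadget m) + card (apex_edges (vnum m) t) = m \<and>
    lower_count m * vnum m ^ vnum m \<le> card (level t m)"
proof -
  \<comment> \<open>With \<open>D = m / ln m\<close>, the apexes cost at most
    \<open>3 * t * D + D / 2\<close> edges and the cycles at most \<open>D / 2\<close>, together at
    most \<open>K * D\<close>.\<close>
  define K where "K = 3 * real t + 1"
  \<comment> \<open>The 10 is the 8 of \<open>cyc_sum_le\<close> plus 2 for rounding up the two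
    sides; it gives \<open>v \<le> 2 * D + D / 2\<close>.\<close>
  have "\<forall>\<^sub>F m in sequentially. 4 * sqrt (2 * real m) + 10 \<le> real m / ln (real m) / 2"
    by real_asymp
  moreover have "\<forall>\<^sub>F m in sequentially. 2 * real t * real t \<le> real m / ln (real m)"
  proof -
    have "filterlim (\<lambda>m. real m / ln (real m)) at_top sequentially" by real_asymp
    then show ?thesis by (simp add: filterlim_at_top)
  qed
  moreover have "\<forall>\<^sub>F m in sequentially. 6 * real c \<le> ln (real m)" "\<forall>\<^sub>F m in sequentially. K + 3 \<le> ln (real m)"
    by (rule eventually_ln_ge)+
  moreover have "\<forall>\<^sub>F m in sequentially. K + 3 \<le> ln (ln (real m))"
  proof -
    have "filterlim (\<lambda>m. ln (ln (real m))) at_top sequentially" by real_asymp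
    then show ?thesis by (simp add: filterlim_at_top)
  qed
  moreover have "\<forall>\<^sub>F m in sequentially. real m \<le> (real m / ln (real m)) * (real m / ln (real m))"
    by real_asymp
  moreover have "\<forall>\<^sub>F m in sequentially. 0 \<le> ln (real m) - 2 * ln (ln (real m))"
    by real_asymp
  moreover have "\<forall>\<^sub>F m in sequentially. 2 * t * c + 3 \<le> m"
    by (rule eventually_ge_at_top)
  ultimately show ?thesis
  proof eventually_elim
    case (elim m)
    define L where "L = ln (real m)"
    define D where "D = real m / L"
    define q where "q = bip_edges t m"
    define v where "v = vnum m"
    define w where "w = width m"
    have m: "0 < real m" and L: "0 < L" "6 * real c \<le> L" "K + 3 \<le> L" "K + 3 \<le> ln L" "0 \<le> L - 2 * ln L"
      using elim unfolding L_def K_def by auto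
    have DL: "D * L = real m"
      using L(1) by (simp add: D_def)
    have D: "4 * sqrt (2 * real m) + 10 \<le> D / 2" "2 * real t * real t \<le> D" "real m \<le> D * D" "0 < D"
      using elim m L(1) by (auto simp: D_def L_def)
    have "0 \<le> D" using D(4) by simp
    then have w: "D \<le> real w" "real w \<le> D + 1"
      unfolding w_def width_def L_def[symmetric] D_def[symmetric] by linarith+
    have cs: "real (cyc_fst m + cyc_snd m) \<le> 4 * sqrt (2 * real m) + 8"
      by (rule cyc_sum_le)
    have v_eq: "v = 2 * w + (cyc_fst m + cyc_snd m)"
      by (simp add: v_def w_def vnum_def)
    have v: "real v \<le> 3 * D"
      using w cs D(1) unfolding v_eq by simp
    have v0: "0 < v"
      unfolding v_eq cyc_fst_def by simp
    have D3: "3 * D \<le> real m"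
    proof -
      have "D * 3 \<le> D * L"
        using L(3) D(4) unfolding K_def by (intro mult_left_mono) auto
      then show ?thesis using DL by simp
    qed
    \<comment> \<open>One half of \<open>m\<close> pays for \<open>c * v\<close>, by
      \<open>v \<le> 3 * D\<close> and \<open>6 * c \<le> L\<close>, the other half for
      \<open>c * t\<close>.\<close>
    have size: "c * (v + t) < m"
    proof -
      have "D * (6 * real c) \<le> D * L"
        using L(2) D(4) by (intro mult_left_mono) auto
      then have 1: "6 * (D * real c) \<le> real m"
        using DL by simp
      have "real c * real v \<le> real c * (3 * D)"
        using v by (intro mult_left_mono) auto
      then have 2: "2 * (real c * real v) \<le> real m"
        using 1 by (simp add: algebra_simps)
      have "real (2 * t * c + 3) \<le> real m"
        using elim by (simp only: of_nat_le_iff)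
      then have 3: "2 * (real c * real t) < real m"
        by (simp add: algebra_simps)
      have "real (c * (v + t)) < real m"
        using 2 3 by (simp add: algebra_simps)
      then show ?thesis by (simp only: of_nat_less_iff)
    qed
    have loss: "real (card (apex_edges v t) + card (gadget m)) \<le> K * D"
    proof -
      have "real (card (apex_edges v t)) \<le> real (t * (v + t))"
        using card_apex_edges_le of_nat_le_iff by blast
      also have "\<dots> = real t * real v + real t * real t"
        by (simp add: algebra_simps)
      also have "\<dots> \<le> real t * (3 * D) + D / 2"
        using v D(2) by (intro add_mono mult_left_mono) auto
      finally have "real (card (apex_edges v t)) \<le> real t * (3 * D) + D / 2" .
      moreover have "real (card (gadget m)) \<le> real (cyc_fst m + cyc_snd m)"
        using gadget_facts(3) of_nat_le_iff by blast
      ultimately show ?thesis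
        using cs D(1) by (simp add: K_def algebra_simps)
    qed
    have KD: "K * D < real m"
    proof -
      have "D * K < D * L"
        using L(3) D(4) by (intro mult_strict_left_mono) auto
      then show ?thesis using DL by (simp add: mult.commute)
    qed
    have "card (apex_edges v t) + card (gadget m) < m"
      using loss KD of_nat_less_iff[where ?'a = real] by (meson le_less_trans)
    then have q: "q + card (gadget m) + card (apex_edges v t) = m"
      unfolding q_def bip_edges_def v_def by simp
    have qm: "q \<le> m"
      using q by simp
    have q_ge: "real m - K * D \<le> real q"
      using loss q by (simp flip: of_nat_add)
    then have q0: "0 < q"
      using KD by (cases q) auto
    have "real (lower_count m * v ^ v) \<le> real ((w * w) choose q)"
    proof -
      have "real v \<le> real m"
        using v D3 by simp
      then have "real v ^ v \<le> real m ^ v"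
        by (intro power_mono) auto
      also have "\<dots> = exp (real v * L)"
        using m by (simp add: L_def exp_of_nat_mult)
      also have "\<dots> \<le> exp (3 * real m)"
      proof -
        have "real v * L \<le> 3 * D * L"
          using v L(1) by (intro mult_right_mono) auto
        then show ?thesis using DL by (simp add: mult.assoc)
      qed
      finally have vv: "real v ^ v \<le> exp (3 * real m)" .
      have "3 \<le> m"
        using elim by simp
      then have "real (lower_count m) \<le> exp (real m * L - 3 * real m * ln L)"
        using lower_count_le_exp unfolding L_def by blast
      then have "real (lower_count m * v ^ v) \<le> exp (real m * L - 3 * real m * ln L) * exp (3 * real m)"
        using vv by (simp add: mult_mono)
      also have "\<dots> = exp (real m * L - 3 * real m * ln L + 3 * real m)"
        by (simp add: exp_add)
      \<comment> \<open>As \<open>D * L = m\<close>, the \<open>K * D\<close> lost edges cost only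
        \<open>K * m\<close> in the exponent. This and the \<open>3 * m\<close> from
        \<open>v ^ v\<close> are covered by the third summand \<open>m * ln L\<close>, because
        \<open>K + 3 \<le> ln L\<close>.\<close>
      also have "\<dots> \<le> exp ((real m - K * D) * (L - 2 * ln L))"
      proof -
        have "real m * (K + 3) \<le> real m * ln L"
          using L(4) m by (intro mult_left_mono) auto
        moreover have "0 \<le> K * D * (2 * ln L)"
          using L(4) D(4) unfolding K_def by (intro mult_nonneg_nonneg) auto
        moreover have "K * D * L = K * real m"
          using DL by (simp add: mult.assoc)
        moreover have "(real m - K * D) * (L - 2 * ln L) =
            real m * L - 2 * (real m * ln L) - K * D * L + K * D * (2 * ln L)"
          by (simp add: algebra_simps)
        moreover have "real m * (K + 3) = K * real m + 3 * real m"
          by (simp add: algebra_simps)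
        ultimately have "real m * L - 3 * real m * ln L + 3 * real m \<le> (real m - K * D) * (L - 2 * ln L)"
          by linarith
        then show ?thesis
          by simp
      qed
      also have "\<dots> \<le> exp (real q * (L - 2 * ln L))"
        using q_ge L(5) by (simp add: mult_right_mono)
      also have "\<dots> = (real m / (L * L)) ^ q"
      proof -
        have "exp (L - 2 * ln L) = real m / (L * L)"
          using m L(1) by (simp add: exp_diff exp_double power2_eq_square L_def)
        then show ?thesis
          by (simp add: exp_of_nat_mult)
      qed
      also have "\<dots> \<le> (real (w * w) / real q) ^ q"
      proof (rule power_mono)
        have "real m / (L * L) = D * D / real m"
          using m L(1) by (simp add: D_def field_simps)
        also have "\<dots> \<le> real (w * w) / real q"
          using w D(4) q0 qm m by (intro frac_le) (auto intro!: mult_mono)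
        finally show "real m / (L * L) \<le> real (w * w) / real q" .
      qed (use m L(1) in simp)
      also have "\<dots> \<le> real ((w * w) choose q)"
      proof (rule binomial_ge_n_over_k_pow_k)
        have "D * D \<le> real w * real w"
          using w D(4) by (intro mult_mono) auto
        then have "real m \<le> real (w * w)"
          using D(3) by simp
        then show "q \<le> w * w"
          using qm of_nat_le_iff[where ?'a = real] by (meson le_trans)
      qed
      finally show ?thesis .
    qed
    then have "lower_count m * v ^ v \<le> (w * w) choose q"
      by (simp only: of_nat_le_iff)
    then show ?case
      using v0 size q unfolding card_level v_def w_def q_def by blast
  qed
qed

section \<open>Growth of the two bounding sequences\<close>

lemma upper_count_asymp:
  "(\<lambda>m. ln (8 * (real m + 1)) + real m * ln (6 * real m + 1) - real m * ln (real m)) \<in> O(\<lambda>m. real m)"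
  by real_asymp

lemma upper_count_eq:
  assumes "0 < m"
  shows "real (upper_count m) = exp (real m * ln (real m) +
    (ln (8 * (real m + 1)) + real m * ln (6 * real m + 1) - real m * ln (real m)))"
proof -
  have "exp (real m * ln (6 * real m + 1)) = (6 * real m + 1) ^ m"
    by (simp add: exp_of_nat_mult add_pos_nonneg)
  then show ?thesis
    by (simp add: upper_count_def exp_add algebra_simps)
qed

text \<open>Passing from the coefficient 3 to 4 makes room for the floor in
  \<open>lower_count\<close>, which may cost up to 1.\<close>

lemma lower_count_asymp:
  "\<forall>\<^sub>F m in sequentially. exp (real m * ln (real m) + (-4) * (real m * ln (ln (real m)))) \<le> real (lower_count m)"
proof -
  have "\<forall>\<^sub>F m in sequentially. exp (real m * ln (real m) + (-4) * (real m * ln (ln (real m)))) \<le>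
      exp (real m * ln (real m) - 3 * real m * ln (ln (real m))) - 1"
    by real_asymp
  moreover have "\<forall>\<^sub>F m in sequentially. (3::nat) \<le> m"
    by (rule eventually_ge_at_top)
  ultimately show ?thesis
  proof eventually_elim
    case (elim m)
    then show ?case
      unfolding lower_count_def by (simp add: not_less) linarith
  qed
qed

section \<open>Realising a given sequence, and conclusion\<close>

lemma start_unique:
  assumes "x \<in> starts S" "y \<in> starts S" "{x..k} \<subseteq> S" "{y..k} \<subseteq> S" "x \<le> k" "y \<le> k"
  shows "x = y"
proof (rule ccontr)
  assume "x \<noteq> y"
  then consider "x < y" | "y < x" by linarith
  then show False
  proof cases
    case 1
    then have "y - 1 \<in> {x..k}" using assms(6) by auto
    then show False using assms(2,3) 1 by (auto simp: starts_def)
  next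
    case 2
    then have "x - 1 \<in> {y..k}" using assms(5) by auto
    then show False using assms(1,4) 2 by (auto simp: starts_def)
  qed
qed

lemma ex_family_with_sat:
  fixes s :: "nat \<Rightarrow> int"
  assumes lin: "(\<lambda>n. real_of_int (s n)) \<in> O(\<lambda>n. real n)"
    and int: "\<forall>\<^sub>F m in sequentially. union_of_at_most_intervals (lower_count m) (int ` {n. s n = int m})"
    and lim: "filterlim s at_top sequentially"
  shows "\<exists>\<F>. graph_family \<F> \<and> (\<forall>\<^sub>F n in sequentially. int (sat n \<F>) = s n)"
proof -
  obtain C where C: "\<forall>\<^sub>F n in sequentially. norm (real_of_int (s n)) \<le> C * norm (real n)"
    using lin landau_o.bigE by blast
  define c where "c = nat \<lceil>C\<rceil>"
  \<comment> \<open>One apex more than the linear constant: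
    \<open>t * (n - t) = t * n - t * t \<ge> c * n\<close> as soon as
    \<open>n \<ge> t * t\<close>.\<close>
  define t where "t = c + 1"
  define Sm where "Sm m = {n. s n = int m}" for m :: nat
  have s_le: "\<forall>\<^sub>F n in sequentially. s n \<le> int (c * n)"
    using C
  proof eventually_elim
    case (elim n)
    have "real_of_int (s n) \<le> C * real n"
      using elim by simp
    also have "\<dots> \<le> real c * real n"
      unfolding c_def by (intro mult_right_mono real_nat_ceiling_ge) simp
    finally have "real_of_int (s n) \<le> real_of_int (int (c * n))"
      by simp
    then show ?case
      by (simp only: of_int_le_iff)
  qed
  have "\<forall>\<^sub>F m in sequentially. union_of_at_most_intervals (lower_count m) (int ` Sm m) \<and>
    0 < vnum m \<and> c * (vnum m + t) < m \<and>
    bip_edges t m + card (gadget m) + card (apex_edges (vnum m) t) = m \<and>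
    lower_count m * vnum m ^ vnum m \<le> card (level t m)"
    using int eventually_level_bounds[of c t] unfolding Sm_def by (rule eventually_conj)
  then obtain M where M: "\<And>m. M \<le> m \<Longrightarrow> union_of_at_most_intervals (lower_count m) (int ` Sm m)"
    "\<And>m. M \<le> m \<Longrightarrow> 0 < vnum m" "\<And>m. M \<le> m \<Longrightarrow> c * (vnum m + t) < m"
    "\<And>m. M \<le> m \<Longrightarrow> bip_edges t m + card (gadget m) + card (apex_edges (vnum m) t) = m"
    "\<And>m. M \<le> m \<Longrightarrow> lower_count m * vnum m ^ vnum m \<le> card (level t m)"
    unfolding eventually_sequentially by blast
  have "\<forall>\<^sub>F n in sequentially. int M \<le> s n \<and> s n \<le> int (c * n) \<and> t * t \<le> n"
    using lim s_le eventually_ge_at_top[of "t * t"] by (auto simp: filterlim_at_top intro!: eventually_conj)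
  then obtain N0 where N0: "\<And>n. N0 \<le> n \<Longrightarrow> int M \<le> s n" "\<And>n. N0 \<le> n \<Longrightarrow> s n \<le> int (c * n)"
    "\<And>n. N0 \<le> n \<Longrightarrow> t * t \<le> n"
    unfolding eventually_sequentially by blast
  \<comment> \<open>Each interval of the level \<open>m\<close>, represented by its start, receives
    its own candidate, and these are pairwise incomparable. There are at most
    \<open>lower_count m\<close> intervals, and the greedy choice supplies that many
    candidates.\<close>
  have "\<exists>\<phi>. inj_on \<phi> (starts (Sm m)) \<and> \<phi> ` starts (Sm m) \<subseteq> level t m \<and>
    (\<forall>x\<in>starts (Sm m). \<forall>y\<in>starts (Sm m). embeds (\<phi> x) (\<phi> y) \<longrightarrow> x = y)" if m: "M \<le> m" for m
  proof -
    have "\<exists>R\<subseteq>level t m. finite R \<and> card R = lower_count m \<and> (\<forall>A\<in>R. \<forall>B\<in>R. embeds A B \<longrightarrow> A = B)"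
      by (rule ex_embedding_antichain[OF M(2)[OF m] _ M(5)[OF m]])
        (use level_facts[of _ t m] in \<open>auto simp: edge_set_def\<close>)
    then obtain R where R: "R \<subseteq> level t m" "finite R" "card R = lower_count m"
      "\<forall>A\<in>R. \<forall>B\<in>R. embeds A B \<longrightarrow> A = B" by blast
    obtain \<phi> where \<phi>: "\<phi> ` starts (Sm m) \<subseteq> R" "inj_on \<phi> (starts (Sm m))"
      using union_of_intervals_starts[OF M(1)[OF m]] R(2,3) card_le_inj by metis
    have "\<forall>x\<in>starts (Sm m). \<forall>y\<in>starts (Sm m). embeds (\<phi> x) (\<phi> y) \<longrightarrow> x = y"
      using R(4) \<phi> by (meson image_subset_iff inj_onD)
    then show ?thesis
      using \<phi> R(1) by (intro exI[of _ \<phi>]) auto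
  qed
  then obtain \<phi> where \<phi>: "\<And>m x. M \<le> m \<Longrightarrow> x \<in> starts (Sm m) \<Longrightarrow> \<phi> m x \<in> level t m"
    "\<And>m x y. M \<le> m \<Longrightarrow> x \<in> starts (Sm m) \<Longrightarrow> y \<in> starts (Sm m) \<Longrightarrow> embeds (\<phi> m x) (\<phi> m y) \<Longrightarrow> x = y"
    unfolding image_subset_iff by metis
  define sn where "sn n = nat (s n)" for n
  have sn: "int (sn n) = s n" "M \<le> sn n" "sn n \<le> c * n" if "N0 \<le> n" for n
    using N0(1,2)[OF that] by (auto simp: sn_def nat_le_iff le_nat_iff)
  have "\<exists>x. N0 \<le> n \<longrightarrow> x \<in> starts (Sm (sn n)) \<and> x \<le> n \<and> {x..n} \<subseteq> Sm (sn n)" for n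
  proof (cases "N0 \<le> n")
    case True
    then have "n \<in> Sm (sn n)"
      using sn(1) by (simp add: Sm_def)
    then show ?thesis
      using ex_start by metis
  qed simp
  then obtain st where st: "\<And>n. N0 \<le> n \<Longrightarrow> st n \<in> starts (Sm (sn n))" "\<And>n. N0 \<le> n \<Longrightarrow> st n \<le> n"
    "\<And>n. N0 \<le> n \<Longrightarrow> {st n..n} \<subseteq> Sm (sn n)"
    by metis
  \<comment> \<open>\<open>Q n\<close> depends only on the value \<open>s n\<close> and on the start
    of the run containing \<open>n\<close>, so it is constant along each interval.\<close>
  define Q where "Q n = \<phi> (sn n) (st n)" for n
  have lvl: "Q n \<in> level t (sn n)" if "N0 \<le> n" for n
    unfolding Q_def using \<phi>(1) sn(2) st(1) that by blast
  interpret extremal_sequence "\<lambda>n. vnum (sn n)" sn Q t N0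
  proof
    show "0 < t"
      by (simp add: t_def)
    fix n assume n: "N0 \<le> n"
    show "edge_set (Q n)" "\<Union>(Q n) \<subseteq> {..<vnum (sn n)}"
      using level_facts[OF lvl[OF n]] by auto
    then show "card (cone (vnum (sn n)) t (Q n)) = sn n"
      using card_cone level_facts(3)[OF lvl[OF n]] M(4)[OF sn(2)[OF n]] by simp
    \<comment> \<open>The candidates were bounded by \<open>c * (v + t) < m\<close> for this
      purpose: \<open>m = sn n\<close> is at most \<open>c * n\<close>, and \<open>c\<close>
      cancels.\<close>
    have "c * (vnum (sn n) + t) < c * n"
      using M(3)[OF sn(2)[OF n]] sn(3)[OF n] by (rule less_le_trans)
    then show "vnum (sn n) + t < n"
      by simp
    have "t * t + c * n \<le> n + c * n"
      using N0(3)[OF n] by simp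
    then have "t * t + c * n \<le> t * n"
      by (simp add: t_def)
    then have "c * n \<le> t * (n - t)"
      by (simp add: diff_mult_distrib2)
    then show "sn n \<le> t * (n - t)"
      using sn(3)[OF n] by simp
    fix k n' assume k: "n \<le> k" "k \<le> n'" and emb: "embeds (Q n) (Q n')"
    have n': "N0 \<le> n'" "N0 \<le> k"
      using n k by auto
    \<comment> \<open>The cycle lengths yield equal values, and then the incomparability of the
      chosen candidates yields equal starts. So \<open>n\<close> and \<open>n'\<close> lie in the
      same run, and with them every \<open>k\<close> in between.\<close>
    have m: "sn n = sn n'"
      using level_embeds[OF lvl[OF n] lvl[OF n'(1)] emb] .
    then have x: "st n = st n'"
      using emb \<phi>(2) sn(2) st(1) n n' unfolding Q_def by metis
    have "k \<in> {st n'..n'}"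
      using k st(2)[OF n] x by simp
    then have "k \<in> Sm (sn n')"
      using st(3)[OF n'(1)] by blast
    then have mk: "sn k = sn n'"
      by (simp add: Sm_def sn_def)
    have "st k = st n'"
    proof (rule start_unique)
      show "{st n'..k} \<subseteq> Sm (sn n')"
        using st(3)[OF n'(1)] k by auto
      show "st n' \<le> k"
        using x st(2)[OF n] k by simp
    qed (use st mk n' in metis)+
    then show "Q k = Q n' \<and> vnum (sn k) = vnum (sn n')"
      using mk by (simp add: Q_def)
  qed
  have "\<forall>\<^sub>F n in sequentially. int (sat n family) = s n"
    unfolding eventually_sequentially using sat_family sn(1) by (intro exI[of _ N0]) simp
  then show ?thesis
    using graph_family_family by blast
qed

theorem theorem1:
  "\<exists>a b :: nat \<Rightarrow> nat.
     (\<exists>g h :: nat \<Rightarrow> real.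
        g \<in> O(\<lambda>m. real m) \<and>
        h \<in> O(\<lambda>m. real m * ln (ln (real m))) \<and>
        (\<forall>m. a m \<ge> b m) \<and>
        (\<forall>\<^sub>F m in sequentially.
           exp (real m * ln (real m) + g m) \<ge> real (a m) \<and>
           real (b m) \<ge> exp (real m * ln (real m) + h m))) \<and>
     (\<forall>\<F>. graph_family \<F> \<longrightarrow>
        (\<lambda>n. real (sat n \<F>)) \<in> O(\<lambda>n. real n) \<and>
        (\<forall>m. union_of_at_most_intervals (a m) (int ` {n. sat n \<F> = m})) \<and>
        (filterlim (\<lambda>n. sat n \<F>) at_top sequentially \<or>
         (\<exists>c. \<forall>\<^sub>F n in sequentially. sat n \<F> = c))) \<and>
     (\<forall>s :: nat \<Rightarrow> int.
        (\<lambda>n. real_of_int (s n)) \<in> O(\<lambda>n. real n) \<and>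
        (\<forall>\<^sub>F m in sequentially.
           union_of_at_most_intervals (b m) (int ` {n. s n = int m})) \<and>
        filterlim s at_top sequentially \<longrightarrow>
        (\<exists>\<F>. graph_family \<F> \<and> (\<forall>\<^sub>F n in sequentially. int (sat n \<F>) = s n))) \<and>
     (\<forall>m. \<exists>\<F>. graph_family \<F> \<and> finite \<F> \<and> (\<forall>\<^sub>F n in sequentially. sat n \<F> = m))"
proof -
  let ?g = "\<lambda>m. ln (8 * (real m + 1)) + real m * ln (6 * real m + 1) - real m * ln (real m)"
  let ?h = "\<lambda>m. (-4) * (real m * ln (ln (real m)))"
  have "\<forall>\<^sub>F m in sequentially. real (upper_count m) \<le> exp (real m * ln (real m) + ?g m)"
    using eventually_gt_at_top[of 0] by eventually_elim (simp only: upper_count_eq order_refl)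
  then have "\<forall>\<^sub>F m in sequentially. exp (real m * ln (real m) + ?g m) \<ge> real (upper_count m) \<and>
      real (lower_count m) \<ge> exp (real m * ln (real m) + ?h m)"
    using lower_count_asymp by (rule eventually_conj)
  moreover have "?h \<in> O(\<lambda>m. real m * ln (ln (real m)))"
    by simp
  ultimately have growth: "\<exists>g h :: nat \<Rightarrow> real.
        g \<in> O(\<lambda>m. real m) \<and>
        h \<in> O(\<lambda>m. real m * ln (ln (real m))) \<and>
        (\<forall>m. upper_count m \<ge> lower_count m) \<and>
        (\<forall>\<^sub>F m in sequentially.
           exp (real m * ln (real m) + g m) \<ge> real (upper_count m) \<and>
           real (lower_count m) \<ge> exp (real m * ln (real m) + h m))"
    using upper_count_asymp lower_count_le_upper_count by (intro exI[of _ ?g] exI[of _ ?h]) blast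
  have intervals: "union_of_at_most_intervals (upper_count m) (int ` {n. sat n \<F> = m})"
    if "graph_family \<F>" for \<F> m
    using union_of_intervals_if_starts[OF sat_level_starts(1)[OF that]]
      sat_level_starts(2)[OF that] sum_choose_pairs_le le_trans by blast
  show ?thesis
    using growth intervals sat_linear sat_dichotomy ex_family_with_sat ex_constant_sat
    by (intro exI[of _ upper_count] exI[of _ lower_count]) blast
qed

end
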